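(* Let $A,B$ be $\mathbb{N}_0$-valued random variables with $0<\mu:=E(A)<1$ and $P(B>x)=x^{-\alpha}L(x)$ for some $\alpha\in(0,1)$ and some slowly varying function $L$. Let $(X_t)_{t\in\mathbb{Z}}$ be the stationary branching process with immigration with offspring variable $A$ and immigration variable $B$, let $S_n=X_1+\cdots+X_n$, and let $(a_n)$ be a sequence of constants such that $nP(X_0>a_nu)\to u^{-\alpha}$ as $n\to\infty$ for every $u>0$. Then there exists an $\alpha$-stable random variable $\mathcal{S}_\alpha$ such that $$\frac{S_n}{a_n}\xrightarrow{d}\mathcal{S}_\alpha\qquad\text{as } n\to\infty.$$
   Context: $\mathbb{N}_0=\{0,1,2,\dots\}$. The stationary branching process with immigration is the strictly stationary process $(X_t)_{t\in\mathbb{Z}}$ with values in $\mathbb{N}_0$ satisfying $X_t=\sum_{i=1}^{X_{t-1}}A^{(t)}_i+B_t$ for all $t$, where $(A^{(t)}_i)_{i,t}$ are i.i.d. copies of $A$, $(B_t)_t$ are i.i.d. copies of $B$ independent of the $A^{(t)}_i$, and $X_{t-1}$ is independent of $\{A^{(s)}_i,B_s: s\ge t,\ i\ge1\}$. Under the stated assumptions $X_0$ is regularly varying with index $\alpha$, so a sequence of constants $(a_n)$ such that $nP(X_0>a_nu)\to u^{-\alpha}$ as $n\to\infty$ for every $u>0$ exists and tends to $\infty$. *)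

theory Defs
  imports "HOL-Probability.Probability"
begin

text \<open>Only the behaviour near infinity matters, so positivity and measurability are
  required on a half-line only.\<close>

definition slowly_varying :: "(real \<Rightarrow> real) \<Rightarrow> bool" where
  "slowly_varying L \<longleftrightarrow>
     (\<exists>x\<^sub>0. (\<forall>x\<ge>x\<^sub>0. L x > 0) \<and> L \<in> borel_measurable (restrict_space borel {x\<^sub>0..})) \<and>
     (\<forall>c>0. ((\<lambda>x. L (c * x) / L x) \<longlongrightarrow> 1) at_top)"

text \<open>\<open>Z\<close> is \<open>\<alpha>\<close>-stable: it is not almost surely constant, and for independent copies
  \<open>Z\<^sub>1, Z\<^sub>2\<close> of \<open>Z\<close> and \<open>a, b > 0\<close> the variable \<open>a Z\<^sub>1 + b Z\<^sub>2\<close> is distributed as \<open>c Z + d\<close>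
  with \<open>c\<^sup>\<alpha> = a\<^sup>\<alpha> + b\<^sup>\<alpha>\<close> and some real \<open>d\<close>. The pair of copies is realised as the
  coordinates of the product of the law with itself.\<close>

definition stable_rv :: "'a measure \<Rightarrow> real \<Rightarrow> ('a \<Rightarrow> real) \<Rightarrow> bool" where
  "stable_rv N \<alpha> Z \<longleftrightarrow>
     prob_space N \<and> Z \<in> borel_measurable N \<and> 0 < \<alpha> \<and> \<alpha> \<le> 2 \<and>
     \<not> (\<exists>c. AE \<omega> in N. Z \<omega> = c) \<and>
     (\<forall>a>0. \<forall>b>0. \<exists>d.
        distr (distr N borel Z \<Otimes>\<^sub>M distr N borel Z) borel (\<lambda>(z\<^sub>1, z\<^sub>2). a * z\<^sub>1 + b * z\<^sub>2) =
        distr N borel (\<lambda>\<omega>. (a powr \<alpha> + b powr \<alpha>) powr (1 / \<alpha>) * Z \<omega> + d))"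

definition strictly_stationary :: "'a measure \<Rightarrow> (int \<Rightarrow> 'a \<Rightarrow> nat) \<Rightarrow> bool" where
  "strictly_stationary M X \<longleftrightarrow>
     (\<forall>h. distr M (\<Pi>\<^sub>M t\<in>UNIV. count_space UNIV) (\<lambda>\<omega> t. X (t + h) \<omega>) =
          distr M (\<Pi>\<^sub>M t\<in>UNIV. count_space UNIV) (\<lambda>\<omega> t. X t \<omega>))"

text \<open>In the locale below, \<open>\<xi> t i\<close> (\<open>i \<ge> 1\<close>) is the number of children, born at time \<open>t\<close>, of the \<open>i\<close>-th member of
  generation \<open>t - 1\<close>, and \<open>\<eta> t\<close> is the number of immigrants at time \<open>t\<close>. All of them are
  gathered into one family, indexed by a disjoint sum, to express joint independence.
  The condition \<open>past_indep\<close> is stated for generated sigma-algebras because \<open>indep_var\<close> requires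
  both variables to have the same value type.\<close>

definition innovations ::
  "(int \<Rightarrow> nat \<Rightarrow> 'a \<Rightarrow> nat) \<Rightarrow> (int \<Rightarrow> 'a \<Rightarrow> nat) \<Rightarrow> (int \<times> nat) + int \<Rightarrow> 'a \<Rightarrow> nat" where
  "innovations \<xi> \<eta> = case_sum (\<lambda>(t, i). \<xi> t i) \<eta>"

definition innovation_index :: "int set \<Rightarrow> ((int \<times> nat) + int) set" where
  "innovation_index T = (T \<times> {1..}) <+> T"

locale stationary_branching_immigration = prob_space M
  for M :: "'a measure"
    and A B :: "'a \<Rightarrow> nat"
    and \<xi> :: "int \<Rightarrow> nat \<Rightarrow> 'a \<Rightarrow> nat"
    and \<eta> :: "int \<Rightarrow> 'a \<Rightarrow> nat"
    and X :: "int \<Rightarrow> 'a \<Rightarrow> nat" +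
  assumes A_rv: "random_variable (count_space UNIV) A"
    and B_rv: "random_variable (count_space UNIV) B"
    and X_rv: "\<And>t. random_variable (count_space UNIV) (X t)"
    and innovations_indep:
      "indep_vars (\<lambda>_. count_space UNIV) (innovations \<xi> \<eta>) (innovation_index UNIV)"
    and offspring_law:
      "\<And>t i. i \<ge> 1 \<Longrightarrow> distr M (count_space UNIV) (\<xi> t i) = distr M (count_space UNIV) A"
    and immigration_law:
      "\<And>t. distr M (count_space UNIV) (\<eta> t) = distr M (count_space UNIV) B"
    and stationary: "strictly_stationary M X"
    and recursion:
      "\<And>t. AE \<omega> in M. X t \<omega> = (\<Sum>i = 1..X (t - 1) \<omega>. \<xi> t i \<omega>) + \<eta> t \<omega>"
    and past_indep:
      "\<And>t. indep_set
         (sets (vimage_algebra (space M) (X (t - 1)) (count_space UNIV)))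
         (sets (vimage_algebra (space M)
            (\<lambda>\<omega>. \<lambda>j\<in>innovation_index {t..}. innovations \<xi> \<eta> j \<omega>)
            (\<Pi>\<^sub>M j\<in>innovation_index {t..}. count_space UNIV)))"

end

theory Submission
  imports Defs
begin

text \<open>
  Everything is expressed by the generating functions \<open>f\<close>, \<open>g\<close> and \<open>G\<close> of \<open>A\<close>, \<open>B\<close> and \<open>X 0\<close> on
  \<open>[0, 1]\<close>. Conditioning on one generation after the other, from the last one backwards, turns the
  transform of the partial sum \<open>S\<^sub>n\<close> into a product,
  \<open>E z^S\<^sub>n = g (v 0) * \<dots> * g (v (n - 1)) * G (v n)\<close> with \<open>v 0 = 1\<close> and \<open>v (j + 1) = z * f (v j)\<close>
  (\<open>pgf_sum\<close>); here \<open>v j\<close> is the generating function of the total progeny of one individual over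
  \<open>j\<close> generations, itself included. So \<open>S\<^sub>n\<close> behaves like a sum of independent immigrant families
  of mean progeny \<open>1 / (1 - \<mu>)\<close> per immigrant.

  Only the behaviour of \<open>g\<close> near \<open>1\<close> matters, and it follows from that of \<open>G\<close>: stationarity gives
  \<open>G w = g w * G (f w)\<close> (\<open>pgf_fixed_point\<close>), and \<open>1 - f w\<close> is asymptotic to \<open>\<mu> * (1 - w)\<close>. For \<open>G\<close>
  the assumed limit of \<open>n * P (X 0 > a n * u)\<close> is carried over to transforms by an Abelian
  argument: \<open>1 - E e^(-s X 0 / a n)\<close> is the integral of \<open>s e^(-s u) P (X 0 > a n * u)\<close>, and
  dominated convergence applies because of a Potter bound (\<open>normalized_tail_bound\<close>). The outcome is
  that \<open>n * (1 - G (x n))\<close> tends to \<open>s^\<alpha> * Gamma (1 - \<alpha>)\<close> whenever \<open>a n * (1 - x n)\<close> tends to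
  \<open>s > 0\<close> (\<open>pgf_limit\<close>), and the same holds for \<open>g\<close> with the additional factor \<open>1 - \<mu>^\<alpha>\<close>
  (\<open>pgf_immigration_limit\<close>).

  For \<open>z = e^(-s / a n)\<close> subcriticality makes \<open>v j\<close> settle geometrically fast at a value \<open>v\<close> with
  \<open>a n * (1 - v)\<close> close to \<open>s / (1 - \<mu>)\<close>. The product is squeezed between \<open>n\<close>-th powers and
  \<open>E e^(-s S\<^sub>n / a n)\<close> tends to \<open>exp (- K * s^\<alpha>)\<close> for some \<open>K > 0\<close>
  (\<open>laplace_partial_sums_limit\<close>). A continuity theorem for Laplace transforms on the half-line
  (\<open>laplace_continuity\<close>) supplies the limit law and the weak convergence. Stability can be read off
  the transform, since
  \<open>exp (- K * (a * s)^\<alpha>) * exp (- K * (b * s)^\<alpha>) = exp (- K * (c * s)^\<alpha>)\<close> for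
  \<open>c^\<alpha> = a^\<alpha> + b^\<alpha>\<close> (\<open>stable_rv_of_laplace_transform\<close>).
\<close>

section \<open>Probability generating functions\<close>

definition pgf :: "'a measure \<Rightarrow> ('a \<Rightarrow> nat) \<Rightarrow> real \<Rightarrow> real" where
  "pgf M N w = (LINT \<omega>|M. w ^ N \<omega>)"

lemma pgf_eq_distr:
  assumes "N \<in> M \<rightarrow>\<^sub>M count_space UNIV"
  shows "pgf M N w = (LINT n|distr M (count_space UNIV) N. w ^ n)"
  using assms unfolding pgf_def by (subst integral_distr) auto

lemma pgf_nonneg: "0 \<le> w \<Longrightarrow> 0 \<le> pgf M N w"
  unfolding pgf_def by simp

lemma (in prob_space) pgf_le_one:
  assumes "0 \<le> w" "w \<le> 1"
  shows "pgf M N w \<le> 1"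
  unfolding pgf_def
  using integral_mono'[of M "\<lambda>_. 1 :: real" "\<lambda>\<omega>. w ^ N \<omega>"] assms by (simp add: power_le_one prob_space)

text \<open>Conditioning on a discrete variable without conditional expectations: independence is applied to
  each event \<open>N = m\<close> separately and the pieces are summed.\<close>

lemma (in prob_space) sums_expectation_nat:
  fixes N :: "'a \<Rightarrow> nat" and h :: "nat \<Rightarrow> 'a \<Rightarrow> real"
  assumes [measurable]: "random_variable (count_space UNIV) N" "\<And>m. random_variable borel (h m)"
    and b: "\<And>m \<omega>. \<bar>h m \<omega>\<bar> \<le> 1"
  shows "(\<lambda>m. expectation (\<lambda>\<omega>. of_bool (N \<omega> = m) * h m \<omega>)) sums expectation (\<lambda>\<omega>. h (N \<omega>) \<omega>)"
proof -
  have [measurable]: "(\<lambda>\<omega>. h (N \<omega>) \<omega>) \<in> borel_measurable M"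
    by (rule measurable_compose_countable) measurable
  have 1: "(\<Sum>m<n. of_bool (N \<omega> = m) * h m \<omega>) = of_bool (N \<omega> < n) * h (N \<omega>) \<omega>" for n \<omega>
    by (induction n) auto
  have int: "integrable M (\<lambda>\<omega>. of_bool (N \<omega> = m) * h m \<omega>)" for m
    by (rule integrable_const_bound[where B=1]) (auto simp: b)
  have "(\<lambda>n. expectation (\<lambda>\<omega>. of_bool (N \<omega> < n) * h (N \<omega>) \<omega>)) \<longlonglongrightarrow> expectation (\<lambda>\<omega>. h (N \<omega>) \<omega>)"
  proof (rule integral_dominated_convergence[where w="\<lambda>_. 1"])
    show "AE \<omega> in M. (\<lambda>n. of_bool (N \<omega> < n) * h (N \<omega>) \<omega>) \<longlonglongrightarrow> h (N \<omega>) \<omega>"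
    proof (rule AE_I2, rule tendsto_eventually)
      fix \<omega> show "\<forall>\<^sub>F n in sequentially. of_bool (N \<omega> < n) * h (N \<omega>) \<omega> = h (N \<omega>) \<omega>"
        using eventually_gt_at_top[of "N \<omega>"] by eventually_elim simp
    qed
  qed (auto simp: b)
  then show ?thesis
    unfolding sums_def 1[symmetric] Bochner_Integration.integral_sum[OF int] .
qed

context prob_space
begin

lemma pgf_mono:
  assumes [measurable]: "random_variable (count_space UNIV) N" and x: "0 \<le> x" "x \<le> y" "y \<le> 1"
  shows "pgf M N x \<le> pgf M N y"
proof -
  have "0 \<le> y" using x by linarith
  then show ?thesis
    unfolding pgf_def using x
    by (intro integral_mono' integrable_const_bound[where B=1]) (auto simp: power_le_one intro: power_mono)
qed

lemma one_minus_pgf_eq: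
  assumes [measurable]: "random_variable (count_space UNIV) N" and x: "0 \<le> x" "x \<le> 1"
  shows "1 - pgf M N x = (1 - x) * expectation (\<lambda>\<omega>. \<Sum>j<N \<omega>. x ^ j)"
proof -
  have "1 - pgf M N x = expectation (\<lambda>\<omega>. 1 - x ^ N \<omega>)"
    unfolding pgf_def using x
    by (subst Bochner_Integration.integral_diff)
      (auto simp: prob_space power_le_one intro!: integrable_const_bound[where B=1])
  then show ?thesis
    by (simp add: one_diff_power_eq)
qed

lemma one_minus_pgf_le:
  assumes [measurable]: "random_variable (count_space UNIV) N"
    and int: "integrable M (\<lambda>\<omega>. real (N \<omega>))" and x: "0 \<le> x" "x \<le> 1"
  shows "1 - pgf M N x \<le> expectation (\<lambda>\<omega>. real (N \<omega>)) * (1 - x)"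
proof -
  have "expectation (\<lambda>\<omega>. \<Sum>j<N \<omega>. x ^ j) \<le> expectation (\<lambda>\<omega>. real (N \<omega>))"
  proof (rule integral_mono'[OF int])
    show "(\<Sum>j<N \<omega>. x ^ j) \<le> real (N \<omega>)" for \<omega>
      using sum_mono[of "{..<N \<omega>}" "\<lambda>j. x ^ j" "\<lambda>_. 1"] x by (simp add: power_le_one)
  qed simp
  then have "(1 - x) * expectation (\<lambda>\<omega>. \<Sum>j<N \<omega>. x ^ j) \<le> (1 - x) * expectation (\<lambda>\<omega>. real (N \<omega>))"
    using x by (intro mult_left_mono) auto
  then show ?thesis
    using one_minus_pgf_eq[OF assms(1) x] by (simp only: mult.commute)
qed

text \<open>The derivative of a generating function at \<open>1\<close> is the mean, in the scaled form needed below. The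
  geometric sum in \<open>one_minus_pgf_eq\<close> avoids a difference quotient, so \<open>x n = 1\<close> is allowed.\<close>

lemma one_minus_pgf_limit:
  assumes [measurable]: "random_variable (count_space UNIV) N"
    and int: "integrable M (\<lambda>\<omega>. real (N \<omega>))"
    and x: "\<And>n. 0 \<le> x n" "\<And>n. x n \<le> 1" "x \<longlonglongrightarrow> 1"
    and lim: "(\<lambda>n. a n * (1 - x n)) \<longlonglongrightarrow> s"
  shows "(\<lambda>n. a n * (1 - pgf M N (x n))) \<longlonglongrightarrow> s * expectation (\<lambda>\<omega>. real (N \<omega>))"
proof -
  have [measurable]: "(\<lambda>\<omega>. \<Sum>j<N \<omega>. x n ^ j) \<in> borel_measurable M" for n
    by measurable
  have "(\<lambda>n. expectation (\<lambda>\<omega>. \<Sum>j<N \<omega>. x n ^ j)) \<longlonglongrightarrow> expectation (\<lambda>\<omega>. real (N \<omega>))"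
  proof (rule integral_dominated_convergence[OF _ _ int])
    show "AE \<omega> in M. (\<lambda>n. \<Sum>j<N \<omega>. x n ^ j) \<longlonglongrightarrow> real (N \<omega>)"
    proof (rule AE_I2)
      fix \<omega>
      have "(\<lambda>n. \<Sum>j<N \<omega>. x n ^ j) \<longlonglongrightarrow> (\<Sum>j<N \<omega>. 1 ^ j)"
        by (intro tendsto_intros x)
      then show "(\<lambda>n. \<Sum>j<N \<omega>. x n ^ j) \<longlonglongrightarrow> real (N \<omega>)" by simp
    qed
    show "AE \<omega> in M. norm (\<Sum>j<N \<omega>. x n ^ j) \<le> real (N \<omega>)" for n
    proof (rule AE_I2)
      fix \<omega>
      have "(\<Sum>j<N \<omega>. x n ^ j) \<le> (\<Sum>j<N \<omega>. 1)"
        using x by (intro sum_mono power_le_one)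
      then show "norm (\<Sum>j<N \<omega>. x n ^ j) \<le> real (N \<omega>)"
        using x by (simp add: sum_nonneg)
    qed
  qed measurable
  then have "(\<lambda>n. (a n * (1 - x n)) * expectation (\<lambda>\<omega>. \<Sum>j<N \<omega>. x n ^ j)) \<longlonglongrightarrow> s * expectation (\<lambda>\<omega>. real (N \<omega>))"
    by (intro tendsto_mult lim)
  then show ?thesis
    using x by (simp add: one_minus_pgf_eq mult.assoc)
qed

end

section \<open>The joint law of consecutive generations\<close>

text \<open>The population \<open>k\<close> generations after time \<open>t\<close>, started from the constant \<open>m\<close>, as a function of
  a configuration \<open>e\<close> of innovations. Freezing the initial population leaves a functional of the
  innovations alone; the random \<open>X t\<close> is put in afterwards, and so its independence of the future
  is used just once.\<close>

primrec population :: "int \<Rightarrow> nat \<Rightarrow> nat \<Rightarrow> ((int \<times> nat) + int \<Rightarrow> nat) \<Rightarrow> nat" where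
  "population t m 0 e = m"
| "population t m (Suc k) e =
     (\<Sum>i = 1..population t m k e. e (Inl (t + int (Suc k), i))) + e (Inr (t + int (Suc k)))"

lemma innovation_index_iff [simp]:
  "Inl (s, i) \<in> innovation_index T \<longleftrightarrow> s \<in> T \<and> i \<ge> 1"
  "Inr s \<in> innovation_index T \<longleftrightarrow> s \<in> T"
  by (auto simp: innovation_index_def)

lemma population_restrict:
  "{t<..t + int k} \<subseteq> T \<Longrightarrow> population t m k (restrict e (innovation_index T)) = population t m k e"
proof (induction k)
  case (Suc k)
  have "{t<..t + int k} \<subseteq> T" and *: "t + int (Suc k) \<in> T"
    using Suc.prems by auto
  from this(1) have IH: "population t m k (restrict e (innovation_index T)) = population t m k e"
    by (rule Suc.IH)
  show ?case
    unfolding population.simps IH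
    using * by (intro arg_cong2[where f="(+)"] sum.cong) simp_all
qed simp

lemma measurable_add_nat:
  fixes f g :: "'b \<Rightarrow> nat"
  assumes f: "f \<in> P \<rightarrow>\<^sub>M count_space UNIV" and g: "g \<in> P \<rightarrow>\<^sub>M count_space UNIV"
  shows "(\<lambda>x. f x + g x) \<in> P \<rightarrow>\<^sub>M count_space UNIV"
  by (rule measurable_compose_countable[OF measurable_compose[OF g] f]) simp

lemma population_measurable:
  "{t<..t + int k} \<subseteq> T \<Longrightarrow>
    population t m k \<in> (\<Pi>\<^sub>M j\<in>innovation_index T. count_space UNIV) \<rightarrow>\<^sub>M count_space UNIV"
proof (induction k)
  case 0
  have "population t m 0 = (\<lambda>_. m)" by auto
  then show ?case by simp
next
  case (Suc k)
  let ?P = "\<Pi>\<^sub>M j\<in>innovation_index T. count_space (UNIV :: nat set)"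
  define s where "s = t + int (Suc k)"
  have "{t<..t + int k} \<subseteq> T" and s: "s \<in> T"
    using Suc.prems by (auto simp: s_def)
  from this(1) have [measurable]: "population t m k \<in> ?P \<rightarrow>\<^sub>M count_space UNIV"
    by (rule Suc.IH)
  have "(\<lambda>e. (\<Sum>i = 1..l. e (Inl (s, i))) + e (Inr s)) \<in> ?P \<rightarrow>\<^sub>M count_space UNIV" for l
  proof -
    have "(\<lambda>e. \<Sum>i = 1..l. e (Inl (s, i))) \<in> ?P \<rightarrow>\<^sub>M count_space UNIV"
      using s by (induction l) (auto intro!: measurable_add_nat measurable_component_singleton)
    then show ?thesis
      using s by (intro measurable_add_nat measurable_component_singleton) simp_all
  qed
  then have "(\<lambda>e. (\<Sum>i = 1..population t m k e. e (Inl (s, i))) + e (Inr s)) \<in> ?P \<rightarrow>\<^sub>M count_space UNIV"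
    by (rule measurable_compose_countable) measurable
  then show ?case by (simp only: population.simps s_def)
qed

context stationary_branching_immigration
begin

lemma innovations_measurable [measurable]:
  "j \<in> innovation_index UNIV \<Longrightarrow> innovations \<xi> \<eta> j \<in> M \<rightarrow>\<^sub>M count_space UNIV"
  using innovations_indep by (simp add: indep_vars_def)

lemma offspring_measurable [measurable]: "i \<ge> 1 \<Longrightarrow> \<xi> t i \<in> M \<rightarrow>\<^sub>M count_space UNIV"
  using innovations_measurable[of "Inl (t, i)"]
  by (simp add: innovations_def)

lemma immigration_measurable [measurable]: "\<eta> t \<in> M \<rightarrow>\<^sub>M count_space UNIV"
  using innovations_measurable[of "Inr t"]
  by (simp add: innovations_def)

declare A_rv [measurable] B_rv [measurable] X_rv [measurable]

lemma pgf_offspring: "i \<ge> 1 \<Longrightarrow> pgf M (\<xi> t i) w = pgf M A w"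
  by (subst (1 2) pgf_eq_distr) (auto simp: offspring_law)

lemma pgf_immigration: "pgf M (\<eta> t) w = pgf M B w"
  by (subst (1 2) pgf_eq_distr) (auto simp: immigration_law)

lemma marginal_law: "distr M (count_space UNIV) (X t) = distr M (count_space UNIV) (X 0)"
proof -
  let ?P = "\<Pi>\<^sub>M t\<in>(UNIV :: int set). count_space (UNIV :: nat set)"
  have [measurable]: "(\<lambda>\<omega> s. X (s + t) \<omega>) \<in> M \<rightarrow>\<^sub>M ?P" for t
    by (rule measurable_PiM_single') auto
  have eq: "distr M (count_space UNIV) (X t) = distr (distr M ?P (\<lambda>\<omega> s. X (s + t) \<omega>)) (count_space UNIV) (\<lambda>x. x 0)" for t
    by (subst distr_distr) (auto simp: comp_def)
  have "distr M ?P (\<lambda>\<omega> s. X (s + t) \<omega>) = distr M ?P (\<lambda>\<omega> s. X (s + 0) \<omega>)" 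
    using stationary unfolding strictly_stationary_def by simp
  then show ?thesis
    by (subst (1 2) eq) simp
qed

lemma pgf_marginal: "pgf M (X t) w = pgf M (X 0) w"
  by (subst (1 2) pgf_eq_distr) (auto simp: marginal_law[of t])

abbreviation config :: "'a \<Rightarrow> (int \<times> nat) + int \<Rightarrow> nat" where
  "config \<omega> \<equiv> (\<lambda>j. innovations \<xi> \<eta> j \<omega>)"

lemma X_eq_population:
  "AE \<omega> in M. \<forall>k. X (t + int k) \<omega> = population t (X t \<omega>) k (config \<omega>)"
proof -
  have "AE \<omega> in M. \<forall>s. X s \<omega> = (\<Sum>i = 1..X (s - 1) \<omega>. \<xi> s i \<omega>) + \<eta> s \<omega>"
    using recursion by (subst AE_all_countable) auto
  then show ?thesis
  proof eventually_elim
    case (elim \<omega>)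
    show ?case
    proof
      fix k show "X (t + int k) \<omega> = population t (X t \<omega>) k (config \<omega>)"
      proof (induction k)
        case (Suc k)
        have "X (t + int (Suc k)) \<omega> = (\<Sum>i = 1..X (t + int k) \<omega>. \<xi> (t + int (Suc k)) i \<omega>) + \<eta> (t + int (Suc k)) \<omega>"
          using elim[rule_format, of "t + int (Suc k)"] by (simp add: algebra_simps)
        then show ?case by (simp only: Suc.IH population.simps) (simp add: innovations_def)
      qed simp
    qed
  qed
qed

lemma config_measurable:
  "(\<lambda>\<omega>. restrict (config \<omega>) (innovation_index T)) \<in> M \<rightarrow>\<^sub>M (\<Pi>\<^sub>M j\<in>innovation_index T. count_space UNIV)"
  by (rule measurable_restrict, rule innovations_measurable) (auto simp: innovation_index_def)

lemma population_config_measurable [measurable]: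
  "(\<lambda>\<omega>. population t m k (config \<omega>)) \<in> M \<rightarrow>\<^sub>M count_space UNIV"
proof -
  have "(\<lambda>\<omega>. population t m k (restrict (config \<omega>) (innovation_index UNIV))) \<in> M \<rightarrow>\<^sub>M count_space UNIV"
    by (rule measurable_compose[OF config_measurable population_measurable]) simp
  then show ?thesis
    by (simp add: population_restrict)
qed

text \<open>A generation descending from \<open>l\<close> parents is a sum of \<open>l + 1\<close> independent variables.\<close>

lemma generation_step_expectation:
  assumes "0 \<le> w" "w \<le> 1"
  shows "expectation (\<lambda>\<omega>. w ^ ((\<Sum>i = 1..l. \<xi> s i \<omega>) + \<eta> s \<omega>)) = pgf M A w ^ l * pgf M B w"
proof -
  define I :: "((int \<times> nat) + int) set" where "I = insert (Inr s) ((\<lambda>i. Inl (s, i)) ` {1..l})"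
  have I: "I \<subseteq> innovation_index UNIV"
    by (auto simp: I_def innovation_index_def)
  have "indep_vars (\<lambda>_. borel) (\<lambda>j \<omega>. w ^ innovations \<xi> \<eta> j \<omega>) I"
    by (rule indep_vars_compose2[OF indep_vars_subset[OF innovations_indep I]]) simp
  moreover have "integrable M (\<lambda>\<omega>. w ^ innovations \<xi> \<eta> j \<omega>)" if "j \<in> I" for j
    using that I assms innovations_measurable[of j]
    by (intro integrable_const_bound[where B=1]) (auto simp: power_le_one)
  ultimately have "expectation (\<lambda>\<omega>. \<Prod>j\<in>I. w ^ innovations \<xi> \<eta> j \<omega>) = (\<Prod>j\<in>I. pgf M (innovations \<xi> \<eta> j) w)"
    by (subst indep_vars_lebesgue_integral) (auto simp: pgf_def I_def)
  also have "\<dots> = pgf M A w ^ l * pgf M B w"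
    unfolding I_def
    by (subst prod.insert) (auto simp: prod.reindex inj_on_def innovations_def pgf_offspring pgf_immigration)
  also have "(\<lambda>\<omega>. \<Prod>j\<in>I. w ^ innovations \<xi> \<eta> j \<omega>) = (\<lambda>\<omega>. w ^ ((\<Sum>i = 1..l. \<xi> s i \<omega>) + \<eta> s \<omega>))"
    unfolding I_def
    by (subst prod.insert) (auto simp: prod.reindex inj_on_def innovations_def power_add power_sum mult.commute)
  finally show ?thesis .
qed

text \<open>The induction peels off the last generation, which depends on the past through its number of
  parents \<open>P k\<close> only: averaging it replaces the weight \<open>w\<close> on generation \<open>k + 1\<close> by the weight
  \<open>z * pgf M A w\<close> on generation \<open>k\<close> and leaves the immigration factor \<open>pgf M B w\<close>. This is why
  \<open>w\<close> has to vary.\<close>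

lemma population_expectation:
  assumes z: "0 \<le> z" "z \<le> 1" and w: "0 \<le> w" "w \<le> 1"
  shows "expectation (\<lambda>\<omega>. z ^ (\<Sum>j<k. population t m j (config \<omega>)) * w ^ population t m k (config \<omega>))
    = (\<Prod>j<k. pgf M B (((\<lambda>x. z * pgf M A x) ^^ j) w)) * (((\<lambda>x. z * pgf M A x) ^^ k) w) ^ m"
  using w
proof (induction k arbitrary: w)
  case 0
  then show ?case by (simp add: prob_space)
next
  case (Suc k)
  let ?f = "pgf M A" and ?g = "pgf M B"
  define P where "P j \<omega> = population t m j (config \<omega>)" for j \<omega>
  define s where "s = t + int (Suc k)"
  define Y where "Y \<omega> = z ^ (\<Sum>j<Suc k. P j \<omega>)" for \<omega>
  define Q where "Q l \<omega> = w ^ ((\<Sum>i = 1..l. \<xi> s i \<omega>) + \<eta> s \<omega>)" for l \<omega>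
  note w = Suc.prems
  have [measurable]: "P j \<in> M \<rightarrow>\<^sub>M count_space UNIV" for j
    unfolding P_def by measurable
  have [measurable]: "Y \<in> borel_measurable M"
    unfolding Y_def by measurable
  have Q_rv [measurable]: "Q l \<in> borel_measurable M" for l
  proof -
    have "(\<lambda>\<omega>. \<Sum>i = 1..l. \<xi> s i \<omega>) \<in> M \<rightarrow>\<^sub>M count_space UNIV"
      by (induction l) simp_all
    then show ?thesis unfolding Q_def by measurable
  qed
  have Y: "0 \<le> Y \<omega>" "Y \<omega> \<le> 1" and Q: "0 \<le> Q l \<omega>" "Q l \<omega> \<le> 1" for \<omega> l
    using z w by (auto simp: Y_def Q_def power_le_one)
  have fw: "0 \<le> ?f w" "?f w \<le> 1"
    by (auto intro!: pgf_nonneg pgf_le_one w)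
  have zfw: "0 \<le> z * ?f w" "z * ?f w \<le> 1"
    using fw z by (auto intro: mult_le_one)
  have split: "expectation (\<lambda>\<omega>. of_bool (P k \<omega> = l) * (Y \<omega> * Q l \<omega>))
      = ?g w * expectation (\<lambda>\<omega>. of_bool (P k \<omega> = l) * (Y \<omega> * ?f w ^ l))" for l
  proof -
    let ?past = "innovation_index {t<..t + int k}" and ?new = "innovation_index {s}"
    let ?p = "\<lambda>e. of_bool (population t m k e = l) * z ^ (\<Sum>j<Suc k. population t m j e)"
    let ?q = "\<lambda>e. w ^ ((\<Sum>i = 1..l. e (Inl (s, i))) + e (Inr s))"
    have pop [measurable]: "population t m j \<in> (\<Pi>\<^sub>M j\<in>?past. count_space UNIV) \<rightarrow>\<^sub>M count_space UNIV" if "j < Suc k" for j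
      using that by (intro population_measurable) auto
    have [measurable]: "population t m k \<in> (\<Pi>\<^sub>M j\<in>?past. count_space UNIV) \<rightarrow>\<^sub>M count_space UNIV"
      by (rule pop) simp
    have "?p \<in> borel_measurable (\<Pi>\<^sub>M j\<in>?past. count_space UNIV)"
      by (auto simp: power_sum intro!: borel_measurable_times borel_measurable_prod)
    moreover have [measurable]: "(\<lambda>e. e (Inl (s, i))) \<in> (\<Pi>\<^sub>M j\<in>?new. count_space UNIV) \<rightarrow>\<^sub>M count_space UNIV" if "i \<ge> 1" for i
      using that by (intro measurable_component_singleton) simp
    have [measurable]: "(\<lambda>e. e (Inr s)) \<in> (\<Pi>\<^sub>M j\<in>?new. count_space UNIV) \<rightarrow>\<^sub>M count_space UNIV"
      by (intro measurable_component_singleton) simp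
    have "?q \<in> borel_measurable (\<Pi>\<^sub>M j\<in>?new. count_space UNIV)"
      by (auto simp: power_add power_sum intro!: borel_measurable_times borel_measurable_prod)
    ultimately have "indep_var borel (?p \<circ> (\<lambda>\<omega>. restrict (config \<omega>) ?past)) borel (?q \<circ> (\<lambda>\<omega>. restrict (config \<omega>) ?new))"
      by (intro indep_var_compose[OF indep_var_restrict[OF innovations_indep]])
         (auto simp: innovation_index_def s_def)
    moreover have "?p \<circ> (\<lambda>\<omega>. restrict (config \<omega>) ?past) = (\<lambda>\<omega>. of_bool (P k \<omega> = l) * Y \<omega>)"
    proof
      fix \<omega>
      have "population t m j (restrict (config \<omega>) ?past) = P j \<omega>" if "j \<le> k" for j
        unfolding P_def using that by (intro population_restrict) auto
      then show "(?p \<circ> (\<lambda>\<omega>. restrict (config \<omega>) ?past)) \<omega> = of_bool (P k \<omega> = l) * Y \<omega>"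
        by (simp add: Y_def less_Suc_eq_le)
    qed
    moreover have "?q \<circ> (\<lambda>\<omega>. restrict (config \<omega>) ?new) = Q l"
    proof
      fix \<omega>
      have "(\<Sum>i = 1..l. restrict (config \<omega>) ?new (Inl (s, i))) = (\<Sum>i = 1..l. \<xi> s i \<omega>)"
        by (rule sum.cong) (auto simp: innovations_def)
      moreover have "restrict (config \<omega>) ?new (Inr s) = \<eta> s \<omega>"
        by (simp add: innovations_def)
      ultimately show "(?q \<circ> (\<lambda>\<omega>. restrict (config \<omega>) ?new)) \<omega> = Q l \<omega>"
        by (simp add: Q_def)
    qed
    ultimately have "indep_var borel (\<lambda>\<omega>. of_bool (P k \<omega> = l) * Y \<omega>) borel (Q l)"
      by simp
    then have "expectation (\<lambda>\<omega>. (of_bool (P k \<omega> = l) * Y \<omega>) * Q l \<omega>)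
        = expectation (\<lambda>\<omega>. of_bool (P k \<omega> = l) * Y \<omega>) * expectation (Q l)"
      using Y Q by (intro indep_var_lebesgue_integral integrable_const_bound[where B=1]) auto
    also have "expectation (Q l) = ?f w ^ l * ?g w"
      unfolding Q_def by (rule generation_step_expectation) fact+
    finally show ?thesis
      by (simp add: mult_ac flip: integral_mult_right_zero)
  qed
  have YQ: "\<bar>Y \<omega> * Q l \<omega>\<bar> \<le> 1" "\<bar>Y \<omega> * ?f w ^ l\<bar> \<le> 1" for l \<omega>
    using Y[of \<omega>] Q[of l \<omega>] fw by (auto simp: abs_mult intro!: mult_le_one power_le_one)
  have "(\<lambda>l. expectation (\<lambda>\<omega>. of_bool (P k \<omega> = l) * (Y \<omega> * Q l \<omega>)))
      sums expectation (\<lambda>\<omega>. Y \<omega> * Q (P k \<omega>) \<omega>)"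
    by (rule sums_expectation_nat) (simp_all add: YQ)
  moreover have "(\<lambda>l. ?g w * expectation (\<lambda>\<omega>. of_bool (P k \<omega> = l) * (Y \<omega> * ?f w ^ l)))
      sums (?g w * expectation (\<lambda>\<omega>. Y \<omega> * ?f w ^ P k \<omega>))"
    by (intro sums_mult sums_expectation_nat) (simp_all add: YQ)
  ultimately have "expectation (\<lambda>\<omega>. Y \<omega> * Q (P k \<omega>) \<omega>) = ?g w * expectation (\<lambda>\<omega>. Y \<omega> * ?f w ^ P k \<omega>)"
    unfolding split by (rule sums_unique2)
  also have "(\<lambda>\<omega>. Y \<omega> * ?f w ^ P k \<omega>) = (\<lambda>\<omega>. z ^ (\<Sum>j<k. P j \<omega>) * (z * ?f w) ^ P k \<omega>)"
    by (simp add: Y_def power_add power_mult_distrib mult_ac)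
  also have "(\<lambda>\<omega>. Y \<omega> * Q (P k \<omega>) \<omega>) = (\<lambda>\<omega>. z ^ (\<Sum>j<Suc k. P j \<omega>) * w ^ P (Suc k) \<omega>)"
    by (simp add: Y_def Q_def P_def s_def innovations_def)
  also have "expectation (\<lambda>\<omega>. z ^ (\<Sum>j<k. P j \<omega>) * (z * ?f w) ^ P k \<omega>)
      = (\<Prod>j<k. ?g (((\<lambda>x. z * ?f x) ^^ Suc j) w)) * (((\<lambda>x. z * ?f x) ^^ Suc k) w) ^ m"
    unfolding P_def Suc.IH[OF zfw] by (simp only: funpow_Suc_right comp_apply)
  also have "?g w * \<dots> = (\<Prod>j<Suc k. ?g (((\<lambda>x. z * ?f x) ^^ j) w)) * (((\<lambda>x. z * ?f x) ^^ Suc k) w) ^ m"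
    by (simp only: prod.lessThan_Suc_shift funpow_0 mult.assoc)
  finally show ?case
    by (simp only: P_def)
qed

text \<open>For a constant initial population \<open>m\<close> the transform is \<open>c * v ^ m\<close>; averaging over the independent
  random initial population turns \<open>v ^ m\<close> into its generating function at \<open>v\<close>.\<close>

theorem pgf_partial_sums:
  assumes z: "0 \<le> z" "z \<le> 1" and w: "0 \<le> w" "w \<le> 1"
  shows "expectation (\<lambda>\<omega>. z ^ (\<Sum>j<k. X (t + int j) \<omega>) * w ^ X (t + int k) \<omega>)
    = (\<Prod>j<k. pgf M B (((\<lambda>x. z * pgf M A x) ^^ j) w)) * pgf M (X 0) (((\<lambda>x. z * pgf M A x) ^^ k) w)"
proof -
  let ?F = "\<lambda>x. z * pgf M A x"
  define V where "V m \<omega> = z ^ (\<Sum>j<k. population t m j (config \<omega>)) * w ^ population t m k (config \<omega>)" for m \<omega>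
  define c where "c = (\<Prod>j<k. pgf M B ((?F ^^ j) w))"
  define v where "v = (?F ^^ k) w"
  have [measurable]: "V m \<in> borel_measurable M" for m
    unfolding V_def power_sum by measurable
  have V: "0 \<le> V m \<omega>" "V m \<omega> \<le> 1" for m \<omega>
    unfolding V_def using z w by (auto intro!: mult_le_one power_le_one)
  have "0 \<le> (?F ^^ k) w \<and> (?F ^^ k) w \<le> 1"
    using z w by (induction k) (auto intro!: mult_le_one mult_nonneg_nonneg pgf_le_one pgf_nonneg)
  then have v: "0 \<le> v" "v \<le> 1" by (auto simp: v_def)
  have EV: "expectation (V m) = c * v ^ m" for m
    unfolding V_def c_def v_def by (rule population_expectation) fact+
  have split: "expectation (\<lambda>\<omega>. of_bool (X t \<omega> = m) * V m \<omega>)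
      = c * expectation (\<lambda>\<omega>. of_bool (X t \<omega> = m) * v ^ m)" for m
  proof -
    let ?C = "\<lambda>\<omega>. \<lambda>j\<in>innovation_index {t + 1..}. config \<omega> j"
    let ?P = "\<Pi>\<^sub>M j\<in>innovation_index {t + 1..}. count_space (UNIV :: nat set)"
    let ?p = "\<lambda>n. of_bool (n = m) :: real"
    let ?q = "\<lambda>e. z ^ (\<Sum>j<k. population t m j e) * w ^ population t m k e"
    have pop: "population t m j \<in> ?P \<rightarrow>\<^sub>M count_space UNIV" for j
      by (rule population_measurable) auto
    have q: "?q \<in> borel_measurable ?P"
      unfolding power_sum
      by (intro borel_measurable_times borel_measurable_prod measurable_compose[OF pop]) auto
    have qV: "?q (?C \<omega>) = V m \<omega>" for \<omega>
    proof -
      have "population t m j (?C \<omega>) = population t m j (config \<omega>)" for j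
        by (rule population_restrict) auto
      then show ?thesis by (simp only: V_def)
    qed
    have "indep_var borel (\<lambda>\<omega>. ?p (X t \<omega>)) borel (V m)"
      unfolding indep_var_eq
    proof (intro conjI)
      have "{(\<lambda>\<omega>. ?p (X t \<omega>)) -` S \<inter> space M | S. S \<in> sets borel}
          \<subseteq> sets (vimage_algebra (space M) (X (t + 1 - 1)) (count_space UNIV))" (is "?E1 \<subseteq> ?F1")
      proof safe
        fix S :: "real set"
        have "(\<lambda>\<omega>. ?p (X t \<omega>)) -` S \<inter> space M = X (t + 1 - 1) -` (?p -` S) \<inter> space M" by auto
        then show "(\<lambda>\<omega>. ?p (X t \<omega>)) -` S \<inter> space M \<in> ?F1"
          by (simp only:) (rule in_vimage_algebra, simp)
      qed
      then have 1: "sigma_sets (space M) ?E1 \<subseteq> ?F1"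
        using sets.sigma_sets_subset[of ?E1 "vimage_algebra (space M) (X (t + 1 - 1)) (count_space UNIV)"]
        by (simp only: space_vimage_algebra)
      have "{V m -` S \<inter> space M | S. S \<in> sets borel} \<subseteq> sets (vimage_algebra (space M) ?C ?P)" (is "?E2 \<subseteq> ?F2")
      proof safe
        fix S :: "real set" assume "S \<in> sets borel"
        then have "?q -` S \<inter> space ?P \<in> sets ?P"
          using q by (rule measurable_sets[rotated])
        then have "?C -` (?q -` S \<inter> space ?P) \<inter> space M \<in> ?F2"
          by (rule in_vimage_algebra)
        also have "?C -` (?q -` S \<inter> space ?P) \<inter> space M = V m -` S \<inter> space M"
          using qV by (auto simp: space_PiM)
        finally show "V m -` S \<inter> space M \<in> ?F2" .
      qed
      then have 2: "sigma_sets (space M) ?E2 \<subseteq> ?F2"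
        using sets.sigma_sets_subset[of ?E2 "vimage_algebra (space M) ?C ?P"]
        by (simp only: space_vimage_algebra)
      show "indep_set (sigma_sets (space M) ?E1) (sigma_sets (space M) ?E2)"
        using past_indep[of "t + 1"] 1 2 unfolding indep_sets2_eq by blast
    qed measurable
    then have "expectation (\<lambda>\<omega>. ?p (X t \<omega>) * V m \<omega>) = expectation (\<lambda>\<omega>. ?p (X t \<omega>)) * expectation (V m)"
      using V by (intro indep_var_lebesgue_integral integrable_const_bound[where B=1]) auto
    then show ?thesis by (simp add: EV)
  qed
  have "(\<lambda>m. expectation (\<lambda>\<omega>. of_bool (X t \<omega> = m) * V m \<omega>)) sums expectation (\<lambda>\<omega>. V (X t \<omega>) \<omega>)"
    using V by (intro sums_expectation_nat) simp_all
  moreover have "(\<lambda>m. c * expectation (\<lambda>\<omega>. of_bool (X t \<omega> = m) * v ^ m)) sums (c * expectation (\<lambda>\<omega>. v ^ X t \<omega>))"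
    using v by (intro sums_mult sums_expectation_nat) (simp_all add: power_le_one)
  ultimately have "expectation (\<lambda>\<omega>. V (X t \<omega>) \<omega>) = c * pgf M (X t) v"
    unfolding split pgf_def by (rule sums_unique2)
  also have "expectation (\<lambda>\<omega>. V (X t \<omega>) \<omega>)
      = expectation (\<lambda>\<omega>. z ^ (\<Sum>j<k. X (t + int j) \<omega>) * w ^ X (t + int k) \<omega>)"
  proof (rule integral_cong_AE)
    show "(\<lambda>\<omega>. V (X t \<omega>) \<omega>) \<in> borel_measurable M"
      by (rule measurable_compose_countable) measurable
    show "(\<lambda>\<omega>. z ^ (\<Sum>j<k. X (t + int j) \<omega>) * w ^ X (t + int k) \<omega>) \<in> borel_measurable M"
      unfolding power_sum by measurable
    show "AE \<omega> in M. V (X t \<omega>) \<omega> = z ^ (\<Sum>j<k. X (t + int j) \<omega>) * w ^ X (t + int k) \<omega>"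
      using X_eq_population[of t] by eventually_elim (simp only: V_def)
  qed
  finally show ?thesis by (simp only: c_def v_def pgf_marginal[of t])
qed

corollary pgf_fixed_point:
  assumes w: "0 \<le> w" "w \<le> 1"
  shows "pgf M (X 0) w = pgf M B w * pgf M (X 0) (pgf M A w)"
proof -
  have "pgf M (X 1) w = pgf M B w * pgf M (X 0) (pgf M A w)"
    unfolding pgf_def[of M "X 1"]
    using pgf_partial_sums[where z=1 and w=w and t=0 and k="Suc 0"] w by simp
  then show ?thesis by (simp only: pgf_marginal[of 1])
qed

corollary pgf_sum:
  assumes z: "0 \<le> z" "z \<le> 1"
  shows "expectation (\<lambda>\<omega>. z ^ (\<Sum>t = 1..int n. X t \<omega>))
    = (\<Prod>j<n. pgf M B (((\<lambda>x. z * pgf M A x) ^^ j) 1)) * pgf M (X 0) (((\<lambda>x. z * pgf M A x) ^^ n) 1)"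
proof -
  have "(\<Sum>t = 1..int n. X t \<omega>) = (\<Sum>j<n. X (1 + int j) \<omega>)" for \<omega>
    by (rule sum.reindex_bij_witness[of _ "\<lambda>j. 1 + int j" "\<lambda>t. nat (t - 1)"]) auto
  then show ?thesis
    using pgf_partial_sums[where z=z and w=1 and t=1 and k=n] z by simp
qed

lemma tail_immigration_le:
  "prob {\<omega> \<in> space M. real (B \<omega>) > x} \<le> prob {\<omega> \<in> space M. real (X 0 \<omega>) > x}"
proof -
  have law: "prob {\<omega> \<in> space M. real (N \<omega>) > x} = measure (distr M (count_space UNIV) N) {n. real n > x}"
    if "N \<in> M \<rightarrow>\<^sub>M count_space UNIV" for N
    using that by (subst measure_distr) (auto intro!: arg_cong[where f=prob])
  have "prob {\<omega> \<in> space M. real (B \<omega>) > x} = prob {\<omega> \<in> space M. real (\<eta> 1 \<omega>) > x}"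
    by (subst (1 2) law) (auto simp: immigration_law)
  also have "\<dots> \<le> prob {\<omega> \<in> space M. real (X 1 \<omega>) > x}"
  proof (rule finite_measure_mono_AE)
    show "AE \<omega> in M. \<omega> \<in> {\<omega> \<in> space M. real (\<eta> 1 \<omega>) > x} \<longrightarrow> \<omega> \<in> {\<omega> \<in> space M. real (X 1 \<omega>) > x}"
      using recursion[of 1]
    proof eventually_elim
      case (elim \<omega>)
      then have "\<eta> 1 \<omega> \<le> X 1 \<omega>" by simp
      then show ?case by auto
    qed
  qed measurable
  also have "\<dots> = prob {\<omega> \<in> space M. real (X 0 \<omega>) > x}"
    by (subst (1 2) law) (auto simp: marginal_law[of 1])
  finally show ?thesis .
qed

end

section \<open>Regularly varying tails along a sequence\<close>

lemma antimono_less_cancel: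
  fixes F :: "real \<Rightarrow> real"
  shows "antimono F \<Longrightarrow> F x < F y \<Longrightarrow> y < x"
  by (rule ccontr) (auto dest: antimonoD[of F x y])

text \<open>A bound \<open>a n < K\<close> would keep \<open>F (a n)\<close> above \<open>F K > 0\<close>, although it is of order \<open>1 / n\<close>.\<close>

lemma filterlim_scaling_at_top:
  fixes F :: "real \<Rightarrow> real" and a :: "nat \<Rightarrow> real"
  assumes anti: "antimono F" and pos: "\<And>x. 0 < F x"
    and lim: "\<And>u. u > 0 \<Longrightarrow> (\<lambda>n. real n * F (a n * u)) \<longlonglongrightarrow> u powr (-\<alpha>)"
  shows "filterlim a at_top sequentially"
  unfolding filterlim_at_top
proof
  fix K :: real
  have "(\<lambda>n. real n * F (a n) * inverse (real n)) \<longlonglongrightarrow> 1 * 0"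
    using lim[of 1] by (intro tendsto_mult lim_inverse_n) simp
  then have "\<forall>\<^sub>F n in sequentially. real n * F (a n) * inverse (real n) < F K"
    using pos[of K] by (intro order_tendstoD(2)) auto
  then show "\<forall>\<^sub>F n in sequentially. K \<le> a n"
    using eventually_gt_at_top[of 0]
  proof eventually_elim
    case (elim n)
    then have "F (a n) < F K" by (simp add: field_simps)
    then show ?case
      using antimono_less_cancel[OF anti] by (intro less_imp_le)
  qed
qed

text \<open>Regular variation is assumed along the sequence \<open>a\<close> only. To reach an arbitrary large \<open>x\<close>, take
  \<open>n\<close> as the integer part of \<open>1 / F x\<close>: then \<open>n * F x\<close> is close to \<open>1\<close>, which traps \<open>x\<close> between
  \<open>a n * (1 - \<epsilon>)\<close> and \<open>a n * (1 + \<epsilon>)\<close>, where the limits are known. The exact exponent would be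
  \<open>\<alpha>\<close>; any \<open>\<beta> > \<alpha>\<close> leaves room for the error made by \<open>\<epsilon>\<close>.\<close>

lemma tail_halving_bound:
  fixes F :: "real \<Rightarrow> real" and a :: "nat \<Rightarrow> real"
  assumes anti: "antimono F" and pos: "\<And>x. 0 < F x" and F0: "(F \<longlongrightarrow> 0) at_top"
    and lim: "\<And>u. u > 0 \<Longrightarrow> (\<lambda>n. real n * F (a n * u)) \<longlonglongrightarrow> u powr (-\<alpha>)"
    and \<alpha>: "0 < \<alpha>" "\<alpha> < \<beta>"
  shows "\<exists>x\<^sub>0>0. \<forall>x\<ge>x\<^sub>0. F (x / 2) \<le> 2 powr \<beta> * F x"
proof -
  have "((\<lambda>\<epsilon>. 2 powr \<beta> * (1 + \<epsilon>) powr (-\<alpha>) - ((1 - \<epsilon>) / 2) powr (-\<alpha>))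
      \<longlongrightarrow> 2 powr \<beta> * (1 + 0) powr (-\<alpha>) - ((1 - 0) / 2) powr (-\<alpha>)) (at_right 0)"
    by (intro tendsto_intros) auto
  moreover have "2 powr \<beta> * (1 + 0) powr (-\<alpha>) - ((1 - 0) / 2) powr (-\<alpha>) > (0::real)"
    using \<alpha> by (simp add: powr_divide powr_minus field_simps)
  ultimately have "\<forall>\<^sub>F \<epsilon> in at_right 0. 0 < 2 powr \<beta> * (1 + \<epsilon>) powr (-\<alpha>) - ((1 - \<epsilon>) / 2) powr (-\<alpha>)"
    by (rule order_tendstoD(1))
  moreover have "\<forall>\<^sub>F \<epsilon> in at_right (0::real). \<epsilon> < 1"
    by (auto simp: eventually_at_right_field intro: exI[of _ 1])
  moreover have "\<forall>\<^sub>F \<epsilon> in at_right (0::real). 0 < \<epsilon>"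
    by (rule eventually_at_right_less)
  ultimately have "\<forall>\<^sub>F \<epsilon> in at_right 0. 0 < \<epsilon> \<and> \<epsilon> < 1 \<and> ((1 - \<epsilon>) / 2) powr (-\<alpha>) < 2 powr \<beta> * (1 + \<epsilon>) powr (-\<alpha>)"
    by eventually_elim auto
  then obtain \<epsilon> where \<epsilon>: "0 < \<epsilon>" "\<epsilon> < 1" "((1 - \<epsilon>) / 2) powr (-\<alpha>) < 2 powr \<beta> * (1 + \<epsilon>) powr (-\<alpha>)"
    using eventually_happens trivial_limit_at_right_real by blast
  have lo: "1 < (1 - \<epsilon>) powr (-\<alpha>)"
    using powr_less_mono2_neg[of "-\<alpha>" "1 - \<epsilon>" 1] \<epsilon> \<alpha> by simp
  have hi: "(1 + \<epsilon>) powr (-\<alpha>) < 1"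
    using powr_less_mono2_neg[of "-\<alpha>" 1 "1 + \<epsilon>"] \<epsilon> \<alpha> by simp
  \<comment> \<open>A threshold strictly between \<open>(1 + \<epsilon>) powr (-\<alpha>)\<close> and \<open>1\<close>, since \<open>n * F x\<close> is only close to \<open>1\<close>.\<close>
  define \<delta> where "\<delta> = (1 + (1 + \<epsilon>) powr (-\<alpha>)) / 2"
  have \<delta>: "(1 + \<epsilon>) powr (-\<alpha>) < \<delta>" "\<delta> < 1"
    using hi by (auto simp: \<delta>_def)
  have "(\<lambda>n. 2 powr \<beta> * (real n * F (a n * (1 + \<epsilon>))) - real n * F (a n * ((1 - \<epsilon>) / 2)))
      \<longlonglongrightarrow> 2 powr \<beta> * (1 + \<epsilon>) powr (-\<alpha>) - ((1 - \<epsilon>) / 2) powr (-\<alpha>)"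
    using \<epsilon> by (intro tendsto_diff tendsto_mult tendsto_const lim) auto
  then have "\<forall>\<^sub>F n in sequentially. 0 < 2 powr \<beta> * (real n * F (a n * (1 + \<epsilon>))) - real n * F (a n * ((1 - \<epsilon>) / 2))"
    by (rule order_tendstoD(1)) (use \<epsilon> in simp)
  moreover have "\<forall>\<^sub>F n in sequentially. 1 < real n * F (a n * (1 - \<epsilon>))"
    by (rule order_tendstoD(1)[OF lim lo]) (use \<epsilon> in simp)
  moreover have "\<forall>\<^sub>F n in sequentially. real n * F (a n * (1 + \<epsilon>)) < \<delta>"
    by (rule order_tendstoD(2)[OF lim \<delta>(1)]) (use \<epsilon> in simp)
  moreover have "\<forall>\<^sub>F n :: nat in sequentially. n > 0"
    by (rule eventually_gt_at_top)
  ultimately have "\<forall>\<^sub>F n in sequentially. 0 < n \<and>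
      F (a n * ((1 - \<epsilon>) / 2)) \<le> 2 powr \<beta> * F (a n * (1 + \<epsilon>)) \<and>
      1 < real n * F (a n * (1 - \<epsilon>)) \<and> real n * F (a n * (1 + \<epsilon>)) < \<delta>"
  proof eventually_elim
    case (elim n)
    then have "0 < real n * (2 powr \<beta> * F (a n * (1 + \<epsilon>)) - F (a n * ((1 - \<epsilon>) / 2)))"
      by (simp add: algebra_simps)
    with elim show ?case by (simp add: zero_less_mult_iff)
  qed
  then obtain N where N: "\<And>n. n \<ge> N \<Longrightarrow> 0 < n \<and>
      F (a n * ((1 - \<epsilon>) / 2)) \<le> 2 powr \<beta> * F (a n * (1 + \<epsilon>)) \<and>
      1 < real n * F (a n * (1 - \<epsilon>)) \<and> real n * F (a n * (1 + \<epsilon>)) < \<delta>"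
    by (auto simp: eventually_sequentially)
  have "\<forall>\<^sub>F x in at_top. F x < min (1 - \<delta>) (inverse (real N + 1))"
    using F0 \<delta> by (intro order_tendstoD(2)) auto
  then obtain x\<^sub>1 where x\<^sub>1: "\<And>x. x \<ge> x\<^sub>1 \<Longrightarrow> F x < 1 - \<delta> \<and> F x < inverse (real N + 1)"
    by (auto simp: eventually_at_top_linorder)
  show ?thesis
  proof (intro exI[of _ "max 1 x\<^sub>1"] conjI allI impI)
    fix x assume "max 1 x\<^sub>1 \<le> x"
    then have x: "F x < 1 - \<delta>" "F x < inverse (real N + 1)"
      using x\<^sub>1 by auto
    define n where "n = nat \<lfloor>1 / F x\<rfloor>"
    have "1 / F x > real N + 1"
      using x(2) pos[of x] by (simp add: field_simps)
    then have "n \<ge> N" unfolding n_def by linarith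
    note n = N[OF this]
    have "real n \<le> 1 / F x" "1 / F x - 1 < real n"
      unfolding n_def using \<open>1 / F x > real N + 1\<close> by linarith+
    then have nF: "real n * F x \<le> 1" "1 - F x < real n * F x"
      using pos[of x] by (auto simp: field_simps)
    have "F x < F (a n * (1 - \<epsilon>))"
      using nF(1) n by (smt (verit) mult_le_cancel_left_pos of_nat_0_less_iff)
    then have "a n * (1 - \<epsilon>) < x"
      using antimono_less_cancel[OF anti] by simp
    then have 1: "F (x / 2) \<le> F (a n * ((1 - \<epsilon>) / 2))"
      by (intro antimonoD[OF anti]) simp
    have "real n * F (a n * (1 + \<epsilon>)) < real n * F x"
      using nF(2) n x by linarith
    then have "F (a n * (1 + \<epsilon>)) < F x"
      using n by simp
    then have "2 powr \<beta> * F (a n * (1 + \<epsilon>)) \<le> 2 powr \<beta> * F x"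
      by simp
    with 1 n show "F (x / 2) \<le> 2 powr \<beta> * F x"
      by linarith
  qed simp
qed

text \<open>Potter's bound, obtained by iterating the halving bound down from \<open>a n\<close> to \<open>a n * u\<close>. For
  \<open>\<beta> < 1\<close> its right-hand side is integrable at \<open>0\<close>, and the constant term covers \<open>u \<ge> 1\<close>, so it
  serves as a dominating function.\<close>

lemma normalized_tail_bound:
  fixes F :: "real \<Rightarrow> real" and a :: "nat \<Rightarrow> real"
  assumes anti: "antimono F" and pos: "\<And>x. 0 < F x" and le1: "\<And>x. F x \<le> 1" and F0: "(F \<longlongrightarrow> 0) at_top"
    and lim: "\<And>u. u > 0 \<Longrightarrow> (\<lambda>n. real n * F (a n * u)) \<longlonglongrightarrow> u powr (-\<alpha>)"
    and \<alpha>: "0 < \<alpha>" "\<alpha> < \<beta>"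
  shows "\<exists>C. \<forall>\<^sub>F n in sequentially. \<forall>u>0. real n * F (a n * u) \<le> C * (1 + u powr (-\<beta>))"
proof -
  obtain x\<^sub>0 where x\<^sub>0: "x\<^sub>0 > 0" and half: "\<And>x. x \<ge> x\<^sub>0 \<Longrightarrow> F (x / 2) \<le> 2 powr \<beta> * F x"
    using tail_halving_bound[OF anti pos F0 lim \<alpha>] by auto
  have iter: "F (x / 2 ^ Suc k) \<le> (2 powr \<beta>) ^ Suc k * F x" if "x / 2 ^ k \<ge> x\<^sub>0" for x k
    using that
  proof (induction k)
    case 0
    then show ?case using half by simp
  next
    case (Suc k)
    have "x / 2 ^ Suc k > 0"
      using Suc.prems x\<^sub>0 by linarith
    then have "x > 0"
      by (simp add: zero_less_divide_iff)
    then have "x / 2 ^ Suc k \<le> x / 2 ^ k"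
      using \<open>x > 0\<close> by (simp add: field_simps)
    then have IH: "F (x / 2 ^ Suc k) \<le> (2 powr \<beta>) ^ Suc k * F x"
      using Suc by linarith
    have "F (x / 2 ^ Suc k / 2) \<le> 2 powr \<beta> * F (x / 2 ^ Suc k)"
      by (rule half) fact
    also have "\<dots> \<le> 2 powr \<beta> * ((2 powr \<beta>) ^ Suc k * F x)"
      by (intro mult_left_mono IH) simp
    finally show ?case by (simp add: mult_ac)
  qed
  have potter: "F (x * u) \<le> 2 powr \<beta> * u powr (-\<beta>) * F x" if u: "0 < u" "u \<le> 1" and xu: "x * u \<ge> x\<^sub>0" for x u
  proof -
    define k where "k = nat \<lfloor>log 2 (1 / u)\<rfloor>"
    have nn: "log 2 (1 / u) \<ge> 0" using u by simp
    then have "real k \<le> log 2 (1 / u)" "log 2 (1 / u) < real (Suc k)"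
      unfolding k_def by linarith+
    then have k: "2 ^ k \<le> 1 / u" "1 / u < 2 ^ Suc k"
      using u by (auto simp: le_log_iff log_less_iff simp del: of_nat_Suc power_Suc simp flip: powr_realpow)
    have x: "x > 0" using xu x\<^sub>0 u by (smt (verit) mult_nonpos_nonneg)
    have "x * u \<le> x * (1 / 2 ^ k)"
      using k(1) u x by (intro mult_left_mono) (auto simp: field_simps)
    then have k': "x / 2 ^ k \<ge> x\<^sub>0" using xu by simp
    have "1 / 2 ^ Suc k \<le> u"
      using k(2) u by (auto simp: field_simps simp del: power_Suc)
    then have "x * (1 / 2 ^ Suc k) \<le> x * u"
      using x by (intro mult_left_mono) auto
    then have "F (x * u) \<le> F (x / 2 ^ Suc k)"
      by (intro antimonoD[OF anti]) simp
    also have "\<dots> \<le> (2 powr \<beta>) ^ Suc k * F x"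
      by (rule iter[OF k'])
    also have "(2 powr \<beta>) ^ Suc k = 2 powr \<beta> * (2 ^ k) powr \<beta>"
      by (simp add: powr_power powr_realpow[symmetric] powr_powr mult.commute)
    also have "(2 ^ k) powr \<beta> \<le> (1 / u) powr \<beta>"
      using k(1) \<alpha> by (intro powr_mono2) auto
    also have "(1 / u) powr \<beta> = u powr (-\<beta>)"
      using u by (simp add: powr_divide powr_minus_divide)
    finally show ?thesis
      using pos[of x] by simp
  qed
  define C where "C = 2 * 2 powr \<beta> / F x\<^sub>0 + 2 * 2 powr \<beta> + 2"
  have "filterlim a at_top sequentially"
    by (rule filterlim_scaling_at_top[OF anti pos lim])
  then have "\<forall>\<^sub>F n in sequentially. a n \<ge> x\<^sub>0"
    by (simp add: filterlim_at_top)
  moreover have "\<forall>\<^sub>F n in sequentially. real n * F (a n) < 2"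
    using lim[of 1] by (intro order_tendstoD(2)) auto
  ultimately have "\<forall>\<^sub>F n in sequentially. \<forall>u>0. real n * F (a n * u) \<le> C * (1 + u powr (-\<beta>))"
  proof eventually_elim
    case (elim n)
    have an: "a n > 0" using elim x\<^sub>0 by linarith
    have D: "0 \<le> 2 * 2 powr \<beta> / F x\<^sub>0"
      using pos[of x\<^sub>0] by simp
    show ?case
    proof (intro allI impI)
      fix u :: real assume u: "u > 0"
      consider "u \<ge> 1" | "u \<le> 1" "a n * u \<ge> x\<^sub>0" | "u \<le> 1" "a n * u \<le> x\<^sub>0" by linarith
      then show "real n * F (a n * u) \<le> C * (1 + u powr (-\<beta>))"
      proof cases
        case 1
        have "F (a n * u) \<le> F (a n)"
          using 1 an by (intro antimonoD[OF anti]) simp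
        then have "real n * F (a n * u) \<le> real n * F (a n)"
          by (intro mult_left_mono) auto
        also have "\<dots> \<le> C * 1"
          using elim D by (simp add: C_def) (smt (verit) powr_ge_zero)
        also have "\<dots> \<le> C * (1 + u powr (-\<beta>))"
          using D by (intro mult_left_mono) (auto simp: C_def)
        finally show ?thesis .
      next
        case 2
        have "real n * F (a n * u) \<le> real n * (2 powr \<beta> * u powr (-\<beta>) * F (a n))"
          using 2 u by (intro mult_left_mono potter) auto
        also have "\<dots> = (2 powr \<beta> * u powr (-\<beta>)) * (real n * F (a n))" by simp
        also have "\<dots> \<le> (2 powr \<beta> * u powr (-\<beta>)) * 2"
          using elim by (intro mult_left_mono) auto
        also have "\<dots> = (2 * 2 powr \<beta>) * u powr (-\<beta>)" by simp
        also have "\<dots> \<le> C * (1 + u powr (-\<beta>))"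
          using D by (intro mult_mono) (auto simp: C_def)
        finally show ?thesis .
      next
        case 3
        \<comment> \<open>Below \<open>x\<^sub>0\<close> the tail is only known to be at most \<open>1\<close>, so \<open>n\<close> itself is bounded.\<close>
        define v where "v = x\<^sub>0 / a n"
        have v: "0 < v" "v \<le> 1" "a n * v = x\<^sub>0" "u \<le> v"
          using an x\<^sub>0 elim 3 by (auto simp: v_def field_simps)
        have "F x\<^sub>0 \<le> 2 powr \<beta> * v powr (-\<beta>) * F (a n)"
          using potter[of v "a n"] v by simp
        then have "real n * F x\<^sub>0 \<le> real n * (2 powr \<beta> * v powr (-\<beta>) * F (a n))"
          by (intro mult_left_mono) auto
        also have "\<dots> = (2 powr \<beta> * v powr (-\<beta>)) * (real n * F (a n))" by simp
        also have "\<dots> \<le> (2 powr \<beta> * v powr (-\<beta>)) * 2"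
          using elim by (intro mult_left_mono) auto
        also have "\<dots> \<le> (2 powr \<beta> * u powr (-\<beta>)) * 2"
          using v u \<alpha> by (intro mult_right_mono mult_left_mono powr_mono2') auto
        finally have "real n \<le> (2 * 2 powr \<beta> / F x\<^sub>0) * u powr (-\<beta>)"
          using pos[of x\<^sub>0] by (simp add: field_simps)
        also have "\<dots> \<le> C * (1 + u powr (-\<beta>))"
          using D by (intro mult_mono) (auto simp: C_def)
        finally show ?thesis
          using mult_left_mono[OF le1[of "a n * u"], of "real n"] by simp
      qed
    qed
  qed
  then show ?thesis by blast
qed

section \<open>From tails to transforms\<close>

lemma has_bochner_integral_exp_powr:
  fixes b c :: real
  assumes b: "b < 1" and c: "c > 0"
  shows "has_bochner_integral lborel
    (\<lambda>u. indicator {0<..} u * (exp (- (c * u)) * u powr (-b))) (c powr (b - 1) * Gamma (1 - b))"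
proof (rule has_bochner_integral_nn_integral)
  show "AE u in lborel. 0 \<le> indicator {0<..} u * (exp (- (c * u)) * u powr (-b))"
    by simp
  show "0 \<le> c powr (b - 1) * Gamma (1 - b)"
    using b by (intro mult_nonneg_nonneg Gamma_real_nonneg) auto
  have "ennreal (Gamma (1 - b)) = (\<integral>\<^sup>+t. ennreal (indicator {0..} t * t powr (- b) / exp t) \<partial>lborel)"
    using Gamma_conv_nn_integral_real[of "1 - b"] b by simp
  also have "\<dots> = ennreal c * (\<integral>\<^sup>+u. ennreal (indicator {0..} (0 + c * u) * (0 + c * u) powr (- b) / exp (0 + c * u)) \<partial>lborel)"
    using c by (subst nn_integral_real_affine[where c=c and t=0]) auto
  also have "\<dots> = ennreal c * (\<integral>\<^sup>+u. ennreal (c powr (-b)) * ennreal (indicator {0<..} u * (exp (- (c * u)) * u powr (-b))) \<partial>lborel)"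
  proof (intro arg_cong2[where f="(*)"] refl nn_integral_cong_AE)
    show "AE u in lborel. ennreal (indicator {0..} (0 + c * u) * (0 + c * u) powr (- b) / exp (0 + c * u))
        = ennreal (c powr (-b)) * ennreal (indicator {0<..} u * (exp (- (c * u)) * u powr (-b)))"
      using AE_lborel_singleton[of 0]
    proof eventually_elim
      case (elim u)
      then show ?case
        using c by (cases "u > 0")
          (auto simp: indicator_def powr_mult exp_minus field_simps zero_le_mult_iff simp flip: ennreal_mult')
    qed
  qed
  also have "\<dots> = ennreal (c powr (1 - b)) * (\<integral>\<^sup>+u. ennreal (indicator {0<..} u * (exp (- (c * u)) * u powr (-b))) \<partial>lborel)"
    using c by (subst nn_integral_cmult)
      (auto simp: powr_diff powr_minus field_simps mult.assoc[symmetric] simp flip: ennreal_mult')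
  finally have "ennreal (c powr (b - 1)) * ennreal (Gamma (1 - b))
    = ennreal (c powr (b - 1)) * ennreal (c powr (1 - b)) * (\<integral>\<^sup>+u. ennreal (indicator {0<..} u * (exp (- (c * u)) * u powr (-b))) \<partial>lborel)"
    by (simp add: mult.assoc)
  also have "ennreal (c powr (b - 1)) * ennreal (c powr (1 - b)) = 1"
    using c by (simp flip: ennreal_mult' powr_add)
  finally show "(\<integral>\<^sup>+u. ennreal (indicator {0<..} u * (exp (- (c * u)) * u powr (-b))) \<partial>lborel)
      = ennreal (c powr (b - 1) * Gamma (1 - b))"
    by (simp add: ennreal_mult')
qed measurable

text \<open>Integration by parts, done as Fubini's theorem for
  \<open>1 - e^(-s y) = \<integral> s e^(-s u) 1(0 < u < y) du\<close>.\<close>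

lemma (in prob_space) laplace_transform_tail:
  assumes [measurable]: "random_variable borel Y" and Y: "\<And>\<omega>. 0 \<le> Y \<omega>" and s: "s > 0"
  shows "1 - expectation (\<lambda>\<omega>. exp (- (s * Y \<omega>)))
    = (LINT u|lborel. indicator {0<..} u * (s * exp (- (s * u)) * prob {\<omega> \<in> space M. u < Y \<omega>}))"
proof -
  have inner: "(\<integral>\<^sup>+u. ennreal (indicator {0<..} u * (s * exp (- (s * u)))) * indicator {..<Y \<omega>} u \<partial>lborel)
      = ennreal (1 - exp (- (s * Y \<omega>)))" for \<omega>
  proof -
    have "(\<integral>\<^sup>+u. ennreal (indicator {0<..} u * (s * exp (- (s * u)))) * indicator {..<Y \<omega>} u \<partial>lborel)
        = (\<integral>\<^sup>+u. ennreal (s * exp (- (s * u))) * indicator {0..Y \<omega>} u \<partial>lborel)"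
    proof (rule nn_integral_cong_AE)
      show "AE u in lborel. ennreal (indicator {0<..} u * (s * exp (- (s * u)))) * indicator {..<Y \<omega>} u
          = ennreal (s * exp (- (s * u))) * indicator {0..Y \<omega>} u"
        using AE_lborel_singleton[of 0] AE_lborel_singleton[of "Y \<omega>"]
        by eventually_elim (auto simp: indicator_def)
    qed
    also have "\<dots> = ennreal (- exp (- (s * Y \<omega>)) - (- exp (- (s * 0))))"
      using Y s by (intro nn_integral_FTC_Icc) (auto intro!: derivative_eq_intros)
    finally show ?thesis by simp
  qed
  have "ennreal (1 - expectation (\<lambda>\<omega>. exp (- (s * Y \<omega>)))) = ennreal (expectation (\<lambda>\<omega>. 1 - exp (- (s * Y \<omega>))))"
    using Y s by (subst Bochner_Integration.integral_diff)
      (auto simp: prob_space intro!: integrable_const_bound[where B=1])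
  also have "\<dots> = (\<integral>\<^sup>+\<omega>. ennreal (1 - exp (- (s * Y \<omega>))) \<partial>M)"
    using Y s by (intro nn_integral_eq_integral[symmetric] integrable_const_bound[where B=1]) auto
  also have "\<dots> = (\<integral>\<^sup>+\<omega>. \<integral>\<^sup>+u. ennreal (indicator {0<..} u * (s * exp (- (s * u)))) * indicator {..<Y \<omega>} u \<partial>lborel \<partial>M)"
    by (simp only: inner)
  also have "\<dots> = (\<integral>\<^sup>+u. \<integral>\<^sup>+\<omega>. ennreal (indicator {0<..} u * (s * exp (- (s * u)))) * indicator {..<Y \<omega>} u \<partial>M \<partial>lborel)"
  proof -
    interpret pair_sigma_finite M lborel ..
    have [measurable]: "Measurable.pred (M \<Otimes>\<^sub>M lborel) (\<lambda>x. snd x \<in> {..<Y (fst x)})"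
      unfolding lessThan_iff by measurable
    show ?thesis
      by (rule Fubini'[symmetric]) (simp add: case_prod_beta)
  qed
  also have "\<dots> = (\<integral>\<^sup>+u. ennreal (indicator {0<..} u * (s * exp (- (s * u)) * prob {\<omega> \<in> space M. u < Y \<omega>})) \<partial>lborel)"
  proof (rule nn_integral_cong)
    fix u :: real
    have "(\<integral>\<^sup>+\<omega>. ennreal (indicator {0<..} u * (s * exp (- (s * u)))) * indicator {..<Y \<omega>} u \<partial>M)
        = (\<integral>\<^sup>+\<omega>. ennreal (indicator {0<..} u * (s * exp (- (s * u)))) * indicator {\<omega> \<in> space M. u < Y \<omega>} \<omega> \<partial>M)"
      by (rule nn_integral_cong) (auto simp: indicator_def)
    also have "\<dots> = ennreal (indicator {0<..} u * (s * exp (- (s * u)))) * emeasure M {\<omega> \<in> space M. u < Y \<omega>}"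
      by (rule nn_integral_cmult_indicator) measurable
    also have "\<dots> = ennreal (indicator {0<..} u * (s * exp (- (s * u)) * prob {\<omega> \<in> space M. u < Y \<omega>}))"
      using s by (simp add: emeasure_eq_measure mult.assoc flip: ennreal_mult')
    finally show "(\<integral>\<^sup>+\<omega>. ennreal (indicator {0<..} u * (s * exp (- (s * u)))) * indicator {..<Y \<omega>} u \<partial>M)
        = ennreal (indicator {0<..} u * (s * exp (- (s * u)) * prob {\<omega> \<in> space M. u < Y \<omega>}))" .
  qed
  finally have nn: "(\<integral>\<^sup>+u. ennreal (indicator {0<..} u * (s * exp (- (s * u)) * prob {\<omega> \<in> space M. u < Y \<omega>})) \<partial>lborel)
      = ennreal (1 - expectation (\<lambda>\<omega>. exp (- (s * Y \<omega>))))" ..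
  have "expectation (\<lambda>\<omega>. exp (- (s * Y \<omega>))) \<le> 1"
    using integral_mono'[of M "\<lambda>_. 1 :: real" "\<lambda>\<omega>. exp (- (s * Y \<omega>))"] Y s by (simp add: prob_space)
  moreover have "(\<lambda>u. indicator {0<..} u * (s * exp (- (s * u)) * prob {\<omega> \<in> space M. u < Y \<omega>})) \<in> borel_measurable lborel"
    by measurable
  ultimately have "has_bochner_integral lborel
      (\<lambda>u. indicator {0<..} u * (s * exp (- (s * u)) * prob {\<omega> \<in> space M. u < Y \<omega>}))
      (1 - expectation (\<lambda>\<omega>. exp (- (s * Y \<omega>))))"
    using s nn by (intro has_bochner_integral_nn_integral) auto
  then show ?thesis
    by (simp add: has_bochner_integral_integral_eq)
qed

text \<open>The Abelian step: pass to the limit in the tail representation, where the integrand tends to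
  \<open>s e^(-s u) u^(-\<alpha>)\<close>. The Potter exponent is chosen halfway between \<open>\<alpha>\<close> and \<open>1\<close>. The argument
  \<open>\<sigma> n\<close> varies with \<open>n\<close> because the generating functions of the progeny are evaluated at points
  that are only asymptotically of the form \<open>e^(-s / a n)\<close>.\<close>

lemma (in prob_space) laplace_transform_limit:
  fixes X :: "'a \<Rightarrow> nat" and a \<sigma> :: "nat \<Rightarrow> real"
  assumes [measurable]: "random_variable (count_space UNIV) X"
    and \<alpha>: "0 < \<alpha>" "\<alpha> < 1"
    and pos: "\<And>x. 0 < prob {\<omega> \<in> space M. real (X \<omega>) > x}"
    and lim: "\<And>u. u > 0 \<Longrightarrow>
      (\<lambda>n. real n * prob {\<omega> \<in> space M. real (X \<omega>) > a n * u}) \<longlonglongrightarrow> u powr (-\<alpha>)"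
    and \<sigma>: "\<sigma> \<longlonglongrightarrow> s" "s > 0"
  shows "(\<lambda>n. real n * (1 - expectation (\<lambda>\<omega>. exp (- (\<sigma> n * (real (X \<omega>) / a n))))))
    \<longlonglongrightarrow> s powr \<alpha> * Gamma (1 - \<alpha>)"
proof -
  define F where "F x = prob {\<omega> \<in> space M. real (X \<omega>) > x}" for x
  define \<beta> where "\<beta> = (1 + \<alpha>) / 2"
  have \<beta>: "\<alpha> < \<beta>" "\<beta> < 1" using \<alpha> by (auto simp: \<beta>_def)
  have anti: "antimono F"
    unfolding F_def by (intro antimonoI finite_measure_mono) auto
  have [measurable]: "F \<in> borel_measurable borel"
    unfolding F_def by measurable
  have "((\<lambda>x. 1 - cdf (distr M borel (\<lambda>\<omega>. real (X \<omega>))) x) \<longlongrightarrow> 1 - 1) at_top"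
    by (intro tendsto_diff tendsto_const real_distribution.cdf_lim_at_top_prob real_distribution_distr) measurable
  also have "(\<lambda>x. 1 - cdf (distr M borel (\<lambda>\<omega>. real (X \<omega>))) x) = F"
  proof
    fix x
    have "cdf (distr M borel (\<lambda>\<omega>. real (X \<omega>))) x = prob {\<omega> \<in> space M. real (X \<omega>) \<le> x}"
      unfolding cdf_def by (subst measure_distr) (auto intro!: arg_cong[where f=prob])
    also have "\<dots> = 1 - F x"
      unfolding F_def by (subst prob_compl[symmetric]) (auto intro!: arg_cong[where f=prob])
    finally show "1 - cdf (distr M borel (\<lambda>\<omega>. real (X \<omega>))) x = F x" by simp
  qed
  finally have F0: "(F \<longlongrightarrow> 0) at_top" by simp
  have posF: "0 < F x" for x using pos by (simp add: F_def)
  have limF: "u > 0 \<Longrightarrow> (\<lambda>n. real n * F (a n * u)) \<longlonglongrightarrow> u powr (-\<alpha>)" for u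
    using lim by (simp add: F_def)
  obtain C where C: "\<forall>\<^sub>F n in sequentially. \<forall>u>0. real n * F (a n * u) \<le> C * (1 + u powr (-\<beta>))"
    using normalized_tail_bound[OF anti posF _ F0 limF \<alpha>(1) \<beta>(1)] by (auto simp: F_def)
  have "filterlim a at_top sequentially"
    by (rule filterlim_scaling_at_top[OF anti posF limF])
  then have "\<forall>\<^sub>F n in sequentially. 0 < a n"
    by (simp add: filterlim_at_top_dense)
  moreover have "\<forall>\<^sub>F n in sequentially. s / 2 < \<sigma> n" "\<forall>\<^sub>F n in sequentially. \<sigma> n < 2 * s"
    using order_tendstoD(1)[OF \<sigma>(1), of "s / 2"] order_tendstoD(2)[OF \<sigma>(1), of "2 * s"] \<sigma>(2) by simp_all
  ultimately have "\<forall>\<^sub>F n in sequentially. 0 < a n \<and> s / 2 < \<sigma> n \<and> \<sigma> n < 2 * s \<and>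
      (\<forall>u>0. real n * F (a n * u) \<le> C * (1 + u powr (-\<beta>)))"
    using C by eventually_elim auto
  then obtain N where N: "\<And>n. n \<ge> N \<Longrightarrow> 0 < a n \<and> s / 2 < \<sigma> n \<and> \<sigma> n < 2 * s \<and>
      (\<forall>u>0. real n * F (a n * u) \<le> C * (1 + u powr (-\<beta>)))"
    by (auto simp: eventually_sequentially)
  define h where "h n u = indicator {0<..} u * (\<sigma> n * exp (- (\<sigma> n * u)) * (real n * F (a n * u)))" for n u
  define w where "w u = (2 * s * C) * (indicator {0<..} u * (exp (- (s / 2 * u)) * u powr (- 0)))
      + (2 * s * C) * (indicator {0<..} u * (exp (- (s / 2 * u)) * u powr (-\<beta>)))" for u :: real
  have "(\<lambda>n. LINT u|lborel. h (n + N) u) \<longlonglongrightarrow>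
      (LINT u|lborel. s * (indicator {0<..} u * (exp (- (s * u)) * u powr (-\<alpha>))))"
  proof (rule integral_dominated_convergence[where w=w])
    show "integrable lborel w"
      unfolding w_def using \<beta> \<sigma>(2)
      by (intro Bochner_Integration.integrable_add integrable_mult_right
            integrable.intros[OF has_bochner_integral_exp_powr]) auto
    show "AE u in lborel. (\<lambda>n. h (n + N) u) \<longlonglongrightarrow> s * (indicator {0<..} u * (exp (- (s * u)) * u powr (-\<alpha>)))"
    proof (rule AE_I2)
      fix u :: real
      show "(\<lambda>n. h (n + N) u) \<longlonglongrightarrow> s * (indicator {0<..} u * (exp (- (s * u)) * u powr (-\<alpha>)))"
      proof (cases "u > 0")
        case True
        have "(\<lambda>n. \<sigma> n * exp (- (\<sigma> n * u)) * (real n * F (a n * u))) \<longlonglongrightarrow> s * exp (- (s * u)) * u powr (-\<alpha>)"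
          using True by (intro tendsto_intros \<sigma> limF)
        then have "(\<lambda>n. h n u) \<longlonglongrightarrow> s * (indicator {0<..} u * (exp (- (s * u)) * u powr (-\<alpha>)))"
          using True by (simp add: h_def mult.assoc)
        then show ?thesis by (rule LIMSEQ_ignore_initial_segment)
      qed (simp add: h_def)
    qed
    show "AE u in lborel. norm (h (n + N) u) \<le> w u" for n
    proof (rule AE_I2)
      fix u :: real
      note n = N[OF le_add2[of N n]]
      show "norm (h (n + N) u) \<le> w u"
      proof (cases "u > 0")
        case True
        have "norm (h (n + N) u) = \<sigma> (n + N) * exp (- (\<sigma> (n + N) * u)) * (real (n + N) * F (a (n + N) * u))"
          using True n \<sigma>(2) posF[of "a (n + N) * u"] by (simp add: h_def abs_mult)
        also have "\<dots> \<le> (2 * s) * exp (- (s / 2 * u)) * (C * (1 + u powr (-\<beta>)))"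
        proof (rule mult_mono)
          show "\<sigma> (n + N) * exp (- (\<sigma> (n + N) * u)) \<le> 2 * s * exp (- (s / 2 * u))"
            using True n \<sigma>(2) by (intro mult_mono) auto
        qed (use True n \<sigma>(2) posF[of "a (n + N) * u"] in \<open>auto simp del: of_nat_add\<close>)
        also have "\<dots> = w u"
          using True by (simp add: w_def algebra_simps)
        finally show ?thesis .
      qed (simp add: h_def w_def)
    qed
  qed (auto simp: h_def)
  also have "(LINT u|lborel. s * (indicator {0<..} u * (exp (- (s * u)) * u powr (-\<alpha>)))) = s powr \<alpha> * Gamma (1 - \<alpha>)"
    using has_bochner_integral_integral_eq[OF has_bochner_integral_exp_powr[OF \<alpha>(2) \<sigma>(2)]] \<sigma>(2)
    by (simp add: powr_diff)
  also have "(\<lambda>n. LINT u|lborel. h (n + N) u)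
      = (\<lambda>n. real (n + N) * (1 - expectation (\<lambda>\<omega>. exp (- (\<sigma> (n + N) * (real (X \<omega>) / a (n + N)))))))"
  proof
    fix n
    note n = N[OF le_add2[of N n]]
    have "1 - expectation (\<lambda>\<omega>. exp (- (\<sigma> (n + N) * (real (X \<omega>) / a (n + N)))))
      = (LINT u|lborel. indicator {0<..} u * (\<sigma> (n + N) * exp (- (\<sigma> (n + N) * u)) *
          prob {\<omega> \<in> space M. u < real (X \<omega>) / a (n + N)}))"
      using n \<sigma>(2) by (intro laplace_transform_tail) auto
    also have "\<dots> = (LINT u|lborel. indicator {0<..} u * (\<sigma> (n + N) * exp (- (\<sigma> (n + N) * u)) * F (a (n + N) * u)))"
      using n by (simp add: F_def field_simps)
    finally show "(LINT u|lborel. h (n + N) u)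
        = real (n + N) * (1 - expectation (\<lambda>\<omega>. exp (- (\<sigma> (n + N) * (real (X \<omega>) / a (n + N))))))"
      by (simp add: h_def mult_ac flip: integral_mult_right_zero)
  qed
  finally show ?thesis by (rule LIMSEQ_offset)
qed

lemma tendsto_1_of_scaled:
  fixes a x :: "nat \<Rightarrow> real"
  assumes a: "filterlim a at_top sequentially" and lim: "(\<lambda>n. a n * (1 - x n)) \<longlonglongrightarrow> s"
  shows "x \<longlonglongrightarrow> 1"
proof -
  have "(\<lambda>n. 1 - a n * (1 - x n) * inverse (a n)) \<longlonglongrightarrow> 1 - s * 0"
    by (intro tendsto_intros lim tendsto_inverse_0_at_top a)
  moreover have "\<forall>\<^sub>F n in sequentially. 0 < a n"
    using a by (simp add: filterlim_at_top_dense)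
  then have "\<forall>\<^sub>F n in sequentially. 1 - a n * (1 - x n) * inverse (a n) = x n"
    by eventually_elim (simp add: field_simps)
  ultimately show ?thesis
    using Lim_transform_eventually by fastforce
qed

lemma (in prob_space) pgf_limit:
  fixes X :: "'a \<Rightarrow> nat" and a x :: "nat \<Rightarrow> real"
  assumes [measurable]: "random_variable (count_space UNIV) X"
    and \<alpha>: "0 < \<alpha>" "\<alpha> < 1"
    and pos: "\<And>x. 0 < prob {\<omega> \<in> space M. real (X \<omega>) > x}"
    and lim: "\<And>u. u > 0 \<Longrightarrow>
      (\<lambda>n. real n * prob {\<omega> \<in> space M. real (X \<omega>) > a n * u}) \<longlonglongrightarrow> u powr (-\<alpha>)"
    and a: "filterlim a at_top sequentially"
    and x: "(\<lambda>n. a n * (1 - x n)) \<longlonglongrightarrow> s" "s > 0"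
  shows "(\<lambda>n. real n * (1 - pgf M X (x n))) \<longlonglongrightarrow> s powr \<alpha> * Gamma (1 - \<alpha>)"
proof -
  have ev_a: "\<forall>\<^sub>F n in sequentially. 0 < a n"
    using a by (simp add: filterlim_at_top_dense)
  have x1: "x \<longlonglongrightarrow> 1"
    by (rule tendsto_1_of_scaled[OF a x(1)])
  then have ev_x: "\<forall>\<^sub>F n in sequentially. 0 < x n"
    by (rule order_tendstoD) simp
  define \<sigma> where "\<sigma> n = - a n * ln (x n)" for n
  have "\<sigma> \<longlonglongrightarrow> s"
  proof (rule tendsto_sandwich)
    show "(\<lambda>n. a n * (1 - x n)) \<longlonglongrightarrow> s" by fact
    show "(\<lambda>n. a n * (1 - x n) / x n) \<longlonglongrightarrow> s"
      using tendsto_divide[OF x(1) x1] by simp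
    show "\<forall>\<^sub>F n in sequentially. a n * (1 - x n) \<le> \<sigma> n"
      using ev_a ev_x
    proof eventually_elim
      case (elim n)
      then have "a n * (1 - x n) \<le> a n * (- ln (x n))"
        using ln_le_minus_one[of "x n"] by (intro mult_left_mono) auto
      then show ?case by (simp add: \<sigma>_def)
    qed
    show "\<forall>\<^sub>F n in sequentially. \<sigma> n \<le> a n * (1 - x n) / x n"
      using ev_a ev_x
    proof eventually_elim
      case (elim n)
      have "- ln (x n) \<le> (1 - x n) / x n"
        using ln_le_minus_one[of "inverse (x n)"] elim by (simp add: ln_inverse diff_divide_distrib inverse_eq_divide ln_div)
      then have "a n * (- ln (x n)) \<le> a n * ((1 - x n) / x n)"
        using elim by (intro mult_left_mono) auto
      then show ?case by (simp add: \<sigma>_def)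
    qed
  qed
  then have "(\<lambda>n. real n * (1 - expectation (\<lambda>\<omega>. exp (- (\<sigma> n * (real (X \<omega>) / a n))))))
    \<longlonglongrightarrow> s powr \<alpha> * Gamma (1 - \<alpha>)"
    by (intro laplace_transform_limit pos lim \<alpha> x) simp_all
  moreover have "\<forall>\<^sub>F n in sequentially. real n * (1 - expectation (\<lambda>\<omega>. exp (- (\<sigma> n * (real (X \<omega>) / a n)))))
      = real n * (1 - pgf M X (x n))"
    using ev_a ev_x
  proof eventually_elim
    case (elim n)
    have "exp (- (\<sigma> n * (real k / a n))) = x n ^ k" for k
      using elim by (simp add: \<sigma>_def exp_of_nat_mult mult.commute)
    then show ?case by (simp add: pgf_def)
  qed
  ultimately show ?thesis
    by (rule Lim_transform_eventually)
qed

section \<open>Laplace transforms and weak convergence\<close>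

text \<open>At the integers the Laplace transform gives the moments of \<open>e^(-x)\<close>, which is bounded. Its
  characteristic function is therefore the power series of these moments, and the law of \<open>x\<close> is
  recovered by taking logarithms.\<close>

lemma laplace_transform_unique:
  fixes M1 M2 :: "real measure"
  assumes "real_distribution M1" "real_distribution M2"
    and pos1: "AE x in M1. 0 \<le> x" and pos2: "AE x in M2. 0 \<le> x"
    and eq: "\<And>s. s > 0 \<Longrightarrow> (LINT x|M1. exp (- (s * x))) = (LINT x|M2. exp (- (s * x)))"
  shows "M1 = M2"
proof -
  interpret M1: real_distribution M1 by fact
  interpret M2: real_distribution M2 by fact
  \<comment> \<open>The maximum only matters on a null set; it makes \<open>\<phi>\<close> bounded on the whole line.\<close>
  define \<phi> :: "real \<Rightarrow> real" where "\<phi> x = exp (- max 0 x)" for x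
  have [measurable]: "\<phi> \<in> borel_measurable borel" unfolding \<phi>_def by measurable
  have \<phi>: "0 < \<phi> x" "\<phi> x \<le> 1" for x by (auto simp: \<phi>_def)
  have moment: "(LINT x|M1. \<phi> x ^ k) = (LINT x|M2. \<phi> x ^ k)" for k
  proof (cases "k = 0")
    case True
    then show ?thesis using M1.prob_space M2.prob_space by simp
  next
    case False
    have *: "(LINT x|M. \<phi> x ^ k) = (LINT x|M. exp (- (real k * x)))"
      if "real_distribution M" "AE x in M. 0 \<le> x" for M
    proof -
      interpret real_distribution M by fact
      show ?thesis
      proof (rule integral_cong_AE)
        show "AE x in M. \<phi> x ^ k = exp (- (real k * x))"
          using that(2) by eventually_elim (simp add: \<phi>_def max_def flip: exp_of_nat_mult)
      qed measurable
    qed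
    show ?thesis
      using eq[of "real k"] False *[OF assms(1) pos1] *[OF assms(2) pos2] by simp
  qed
  have char_sums: "(\<lambda>k. (\<i> * of_real t) ^ k / fact k * of_real (LINT x|M. \<phi> x ^ k)) sums char (distr M borel \<phi>) t"
    if "real_distribution M" for M t
  proof -
    interpret real_distribution M by fact
    define f where "f k x = (\<i> * of_real t) ^ k / fact k * of_real (\<phi> x ^ k)" for k x
    have [measurable]: "f k \<in> borel_measurable M" for k unfolding f_def by measurable
    have norm_f: "norm (f k x) \<le> \<bar>t\<bar> ^ k / fact k" for k x
    proof -
      have "\<bar>t\<bar> ^ k * \<phi> x ^ k \<le> \<bar>t\<bar> ^ k * 1"
        using \<phi>[of x] by (intro mult_left_mono power_le_one) auto
      then show ?thesis
        using \<phi>[of x] by (simp add: f_def norm_mult norm_divide norm_power divide_right_mono)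
    qed
    have f_sums: "(\<lambda>k. f k x) sums iexp (t * \<phi> x)" for x
    proof -
      have "(\<lambda>k. (\<i> * of_real (t * \<phi> x)) ^ k /\<^sub>R fact k) sums exp (\<i> * of_real (t * \<phi> x))"
        by (rule exp_converges)
      moreover have "(\<i> * of_real (t * \<phi> x)) ^ k /\<^sub>R fact k = f k x" for k
        by (simp add: f_def scaleR_conv_of_real power_mult_distrib field_simps)
      ultimately show ?thesis by simp
    qed
    have int: "integrable M (f k)" for k
      by (rule integrable_const_bound[where B="\<bar>t\<bar> ^ k / fact k"]) (auto intro: norm_f)
    have exp_summable: "summable (\<lambda>k. \<bar>t\<bar> ^ k / fact k)"
      using summable_exp[of "\<bar>t\<bar>"] by (simp add: field_simps)
    have "(\<lambda>k. integral\<^sup>L M (f k)) sums (LINT x|M. (\<Sum>k. f k x))"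
    proof (rule sums_integral)
      show "AE x in M. summable (\<lambda>k. norm (f k x))"
        by (intro AE_I2 summable_comparison_test'[OF exp_summable, of 0]) (simp add: norm_f)
      have "norm (LINT x|M. norm (f k x)) \<le> \<bar>t\<bar> ^ k / fact k" for k
        using int[of k] by (auto intro!: integral_le_const norm_f)
      then show "summable (\<lambda>k. LINT x|M. norm (f k x))"
        by (intro summable_comparison_test'[OF exp_summable, of 0]) simp
    qed (rule int)
    also have "(\<lambda>x. \<Sum>k. f k x) = (\<lambda>x. iexp (t * \<phi> x))"
      using f_sums by (simp add: sums_iff)
    also have "(LINT x|M. iexp (t * \<phi> x)) = char (distr M borel \<phi>) t"
      unfolding char_def by (subst integral_distr) auto
    also have "(\<lambda>k. integral\<^sup>L M (f k)) = (\<lambda>k. (\<i> * of_real t) ^ k / fact k * of_real (LINT x|M. \<phi> x ^ k))"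
    proof
      fix k
      show "integral\<^sup>L M (f k) = (\<i> * of_real t) ^ k / fact k * of_real (LINT x|M. \<phi> x ^ k)"
        unfolding f_def by (subst integral_mult_right_zero) (simp only: integral_complex_of_real)
    qed
    finally show ?thesis .
  qed
  have "char (distr M1 borel \<phi>) = char (distr M2 borel \<phi>)"
  proof
    fix t
    show "char (distr M1 borel \<phi>) t = char (distr M2 borel \<phi>) t"
      using char_sums[OF assms(1), of t] char_sums[OF assms(2), of t] moment
      by (auto intro: sums_unique2)
  qed
  then have D: "distr M1 borel \<phi> = distr M2 borel \<phi>"
    by (intro Levy_uniqueness M1.real_distribution_distr M2.real_distribution_distr) measurable
  have recover: "distr (distr M borel \<phi>) borel (\<lambda>y. - ln y) = M"
    if "real_distribution M" "AE x in M. 0 \<le> x" for M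
  proof -
    interpret real_distribution M by fact
    have "distr (distr M borel \<phi>) borel (\<lambda>y. - ln y) = distr M borel (\<lambda>x. - ln (\<phi> x))"
      by (subst distr_distr) (auto simp: comp_def)
    also have "\<dots> = distr M borel (\<lambda>x. x)"
    proof (rule distr_cong_AE)
      show "AE x in M. - ln (\<phi> x) = x"
        using that(2) by eventually_elim (simp add: \<phi>_def)
    qed auto
    also have "\<dots> = M" by (intro distr_id2) simp
    finally show ?thesis .
  qed
  show ?thesis
    using trans[OF recover[OF assms(1) pos1, symmetric, unfolded D] recover[OF assms(2) pos2]] .
qed

text \<open>A Laplace transform close to \<open>1\<close> at a single \<open>s > 0\<close> leaves little mass above \<open>1 / s\<close>, because
  there \<open>e^(-s x)\<close> is at most \<open>1 / 2\<close>. The finitely many laws before the convergence sets in are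
  tight one by one.\<close>

lemma tight_of_laplace_transforms:
  fixes \<mu> :: "nat \<Rightarrow> real measure" and \<psi> :: "real \<Rightarrow> real"
  assumes dist: "\<And>n. real_distribution (\<mu> n)"
    and pos: "\<forall>\<^sub>F n in sequentially. AE x in \<mu> n. 0 \<le> x"
    and conv: "\<And>s. s > 0 \<Longrightarrow> (\<lambda>n. LINT x|\<mu> n. exp (- (s * x))) \<longlonglongrightarrow> \<psi> s"
    and \<psi>0: "(\<psi> \<longlongrightarrow> 1) (at_right 0)"
  shows "tight \<mu>"
  unfolding tight_def
proof (intro conjI allI impI dist)
  interpret real_distribution "\<mu> n" for n by (rule dist)
  fix \<epsilon> :: real assume \<epsilon>: "\<epsilon> > 0"
  have "\<forall>\<^sub>F s in at_right 0. 1 - \<epsilon> / 2 < \<psi> s"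
    using \<psi>0 \<epsilon> by (intro order_tendstoD(1)) auto
  moreover have "\<forall>\<^sub>F s in at_right (0::real). 0 < s"
    by (rule eventually_at_right_less)
  ultimately have "\<forall>\<^sub>F s in at_right 0. 0 < s \<and> 1 - \<epsilon> / 2 < \<psi> s"
    by eventually_elim simp
  then obtain s where s: "0 < s" "1 - \<epsilon> / 2 < \<psi> s"
    using eventually_happens trivial_limit_at_right_real by blast
  have "\<forall>\<^sub>F n in sequentially. 1 - \<epsilon> / 2 < (LINT x|\<mu> n. exp (- (s * x)))"
    by (rule order_tendstoD(1)[OF conv[OF s(1)] s(2)])
  with pos have "\<forall>\<^sub>F n in sequentially. (AE x in \<mu> n. 0 \<le> x) \<and> 1 - \<epsilon> / 2 < (LINT x|\<mu> n. exp (- (s * x)))"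
    by eventually_elim simp
  then obtain N where N: "\<And>n. n \<ge> N \<Longrightarrow> (AE x in \<mu> n. 0 \<le> x) \<and> 1 - \<epsilon> / 2 < (LINT x|\<mu> n. exp (- (s * x)))"
    by (auto simp: eventually_sequentially)
  have "\<forall>\<^sub>F b in at_top. 1 - \<epsilon> < measure (\<mu> n) {-b<..b}" for n
  proof -
    have "((\<lambda>b. cdf (\<mu> n) b - cdf (\<mu> n) (- b)) \<longlongrightarrow> 1 - 0) at_top"
      by (intro tendsto_diff cdf_lim_at_top_prob filterlim_compose[OF cdf_lim_at_bot filterlim_uminus_at_bot_at_top])
    then have "\<forall>\<^sub>F b in at_top. 1 - \<epsilon> < cdf (\<mu> n) b - cdf (\<mu> n) (- b)"
      using \<epsilon> by (intro order_tendstoD(1)) auto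
    then show ?thesis
      using eventually_gt_at_top[of 0]
      by eventually_elim (simp add: cdf_diff_eq)
  qed
  then have "\<forall>\<^sub>F b in at_top. \<forall>n\<in>{..<N}. 1 - \<epsilon> < measure (\<mu> n) {-b<..b}"
    by (intro eventually_ball_finite) auto
  moreover have "\<forall>\<^sub>F b in at_top. 1 / s \<le> b \<and> 0 < b"
    by (intro eventually_conj eventually_ge_at_top eventually_gt_at_top)
  ultimately have "\<forall>\<^sub>F b in at_top. 1 / s \<le> b \<and> 0 < b \<and> (\<forall>n<N. 1 - \<epsilon> < measure (\<mu> n) {-b<..b})"
    by eventually_elim auto
  then obtain b where b: "1 / s \<le> b" "0 < b" "\<And>n. n < N \<Longrightarrow> 1 - \<epsilon> < measure (\<mu> n) {-b<..b}"
    using eventually_happens trivial_limit_at_top_linorder by blast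
  have "1 - \<epsilon> < measure (\<mu> n) {-b<..b}" for n
  proof (cases "n < N")
    case False
    then have n: "AE x in \<mu> n. 0 \<le> x" "1 - \<epsilon> / 2 < (LINT x|\<mu> n. exp (- (s * x)))"
      using N[of n] by auto
    have int: "integrable (\<mu> n) (\<lambda>x. exp (- (s * x)))"
      using n(1) s by (intro integrable_const_bound[where B=1]) (auto elim!: eventually_mono)
    have int_ind: "integrable (\<mu> n) (indicator {-b<..b} :: real \<Rightarrow> real)"
      by (rule integrable_const_bound[where B=1]) auto
    have "1 - \<epsilon> < 2 * (LINT x|\<mu> n. exp (- (s * x))) - 1"
      using n(2) by simp
    also have "\<dots> = (LINT x|\<mu> n. 2 * exp (- (s * x)) - 1)"
      using int prob_space[of n] by simp
    also have "\<dots> \<le> (LINT x|\<mu> n. indicator {-b<..b} x)"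
    proof (rule integral_mono_AE)
      show "AE x in \<mu> n. 2 * exp (- (s * x)) - 1 \<le> indicator {-b<..b} x"
        using n(1)
      proof eventually_elim
        case (elim x)
        show ?case
        proof (cases "x \<le> b")
          case True
          then show ?thesis using elim b s by simp
        next
          case False
          have "1 \<le> s * b" using b(1) s(1) by (simp add: field_simps)
          also have "\<dots> \<le> s * x" using False s(1) by (intro mult_left_mono) auto
          finally have "1 \<le> s * x" .
          then have "exp (- (s * x)) \<le> exp (- 1)" by simp
          also have "exp (- 1) \<le> (1 / 2 :: real)"
            using exp_ge_add_one_self[of 1] by (simp add: exp_minus field_simps)
          finally show ?thesis using False by simp
        qed
      qed
    qed (use int int_ind in simp_all)
    also have "\<dots> = measure (\<mu> n) {-b<..b}" by simp
    finally show ?thesis .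
  qed (rule b)
  then show "\<exists>a b. a < b \<and> (\<forall>n. 1 - \<epsilon> < measure (\<mu> n) {a<..b})"
    using b(2) by (intro exI[of _ "- b"] exI[of _ b]) auto
qed

lemma weak_limit_laplace_transform:
  fixes \<mu> :: "nat \<Rightarrow> real measure" and \<nu> :: "real measure" and \<psi> :: "real \<Rightarrow> real"
  assumes dist: "\<And>n. real_distribution (\<mu> n)" "real_distribution \<nu>" and weak: "weak_conv_m \<mu> \<nu>"
    and pos: "\<forall>\<^sub>F n in sequentially. AE x in \<mu> n. 0 \<le> x"
    and conv: "\<And>s. s > 0 \<Longrightarrow> (\<lambda>n. LINT x|\<mu> n. exp (- (s * x))) \<longlonglongrightarrow> \<psi> s"
  shows "AE x in \<nu>. 0 \<le> x" "\<And>s. s > 0 \<Longrightarrow> (LINT x|\<nu>. exp (- (s * x))) = \<psi> s"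
proof -
  interpret \<nu>: real_distribution \<nu> by fact
  interpret \<mu>: real_distribution "\<mu> n" for n by (rule dist)
  define g :: "real \<Rightarrow> real" where "g = (\<lambda>x. min 1 (max 0 (- x)))"
  have "(\<lambda>n. integral\<^sup>L (\<mu> n) g) \<longlonglongrightarrow> integral\<^sup>L \<nu> g"
    by (rule weak_conv_imp_integral_bdd_continuous_conv[OF dist weak, where B=1])
      (auto simp: g_def intro!: continuous_intros)
  moreover have "\<forall>\<^sub>F n in sequentially. integral\<^sup>L (\<mu> n) g = 0"
    using pos
  proof eventually_elim
    case (elim n)
    have "AE x in \<mu> n. g x = 0"
      using elim by eventually_elim (simp add: g_def)
    then show ?case by (rule integral_eq_zero_AE)
  qed
  then have "(\<lambda>n. integral\<^sup>L (\<mu> n) g) \<longlonglongrightarrow> 0"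
    by (rule tendsto_eventually)
  ultimately have "integral\<^sup>L \<nu> g = 0"
    by (rule LIMSEQ_unique)
  moreover have "integrable \<nu> g"
    by (rule \<nu>.integrable_const_bound[where B=1]) (auto simp: g_def)
  ultimately have "AE x in \<nu>. g x = 0"
    by (subst (asm) integral_nonneg_eq_0_iff_AE) (auto simp: g_def)
  then show pos\<nu>: "AE x in \<nu>. 0 \<le> x"
    by eventually_elim (auto simp: g_def min_def max_def split: if_splits)
  fix s :: real assume s: "s > 0"
  define f where "f = (\<lambda>x. exp (- (s * max 0 x)))"
  have f: "(LINT x|M. exp (- (s * x))) = integral\<^sup>L M f"
    if "real_distribution M" "AE x in M. 0 \<le> x" for M
  proof -
    interpret real_distribution M by fact
    show ?thesis
    proof (rule integral_cong_AE)
      show "AE x in M. exp (- (s * x)) = f x"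
        using that(2) by eventually_elim (simp add: f_def)
    qed (auto simp: f_def)
  qed
  have "(\<lambda>n. integral\<^sup>L (\<mu> n) f) \<longlonglongrightarrow> integral\<^sup>L \<nu> f"
    using s by (intro weak_conv_imp_integral_bdd_continuous_conv[OF dist weak, where B=1])
      (auto simp: f_def intro!: continuous_intros)
  moreover have "\<forall>\<^sub>F n in sequentially. integral\<^sup>L (\<mu> n) f = (LINT x|\<mu> n. exp (- (s * x)))"
    using pos by eventually_elim (simp add: f dist)
  ultimately have "(\<lambda>n. LINT x|\<mu> n. exp (- (s * x))) \<longlonglongrightarrow> integral\<^sup>L \<nu> f"
    by (rule Lim_transform_eventually)
  with conv[OF s] have "integral\<^sup>L \<nu> f = \<psi> s"
    by (rule LIMSEQ_unique[rotated])
  then show "(LINT x|\<nu>. exp (- (s * x))) = \<psi> s"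
    using f[OF dist(2) pos\<nu>] by simp
qed

text \<open>Tightness yields a limit along a subsequence; all such limits have the transform \<open>\<psi>\<close> and hence
  coincide, which gives convergence of the whole sequence. That \<open>\<psi>\<close> is a Laplace transform is part
  of the conclusion, so the stable law needs no separate construction.\<close>

theorem laplace_continuity:
  fixes \<mu> :: "nat \<Rightarrow> real measure" and \<psi> :: "real \<Rightarrow> real"
  assumes dist: "\<And>n. real_distribution (\<mu> n)"
    and pos: "\<forall>\<^sub>F n in sequentially. AE x in \<mu> n. 0 \<le> x"
    and conv: "\<And>s. s > 0 \<Longrightarrow> (\<lambda>n. LINT x|\<mu> n. exp (- (s * x))) \<longlonglongrightarrow> \<psi> s"
    and \<psi>0: "(\<psi> \<longlongrightarrow> 1) (at_right 0)"
  obtains \<nu> where "real_distribution \<nu>" "AE x in \<nu>. 0 \<le> x"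
    "\<And>s. s > 0 \<Longrightarrow> (LINT x|\<nu>. exp (- (s * x))) = \<psi> s" "weak_conv_m \<mu> \<nu>"
proof -
  have tight: "tight \<mu>"
    by (rule tight_of_laplace_transforms) fact+
  have limit: "(AE x in \<nu>. 0 \<le> x) \<and> (\<forall>s>0. (LINT x|\<nu>. exp (- (s * x))) = \<psi> s)"
    if r: "strict_mono (r :: nat \<Rightarrow> nat)" and \<nu>: "real_distribution \<nu>" "weak_conv_m (\<mu> \<circ> r) \<nu>" for r \<nu>
  proof -
    note sub = filterlim_subseq[OF r]
    have d: "real_distribution ((\<mu> \<circ> r) n)" for n
      using dist by simp
    have p: "\<forall>\<^sub>F n in sequentially. AE x in (\<mu> \<circ> r) n. 0 \<le> x"
      unfolding comp_def by (rule eventually_compose_filterlim[OF pos sub])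
    have c: "(\<lambda>n. LINT x|(\<mu> \<circ> r) n. exp (- (s * x))) \<longlonglongrightarrow> \<psi> s" if "s > 0" for s
      using filterlim_compose[OF conv[OF that] sub] by (simp add: comp_def)
    show ?thesis
      using weak_limit_laplace_transform[OF d \<nu> p c] by blast
  qed
  obtain r \<nu> where r: "strict_mono (r :: nat \<Rightarrow> nat)" and \<nu>: "real_distribution \<nu>" "weak_conv_m (\<mu> \<circ> r) \<nu>"
    using tight_imp_convergent_subsubsequence[OF tight strict_mono_id] by (auto simp: comp_def id_def)
  note \<nu>_props = limit[OF r \<nu>]
  have "weak_conv_m \<mu> \<nu>"
  proof (rule tight_subseq_weak_converge[OF dist \<nu>(1) tight])
    fix q \<kappa> assume q: "strict_mono (q :: nat \<Rightarrow> nat)" and \<kappa>: "real_distribution \<kappa>" "weak_conv_m (\<mu> \<circ> q) \<kappa>"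
    have "\<kappa> = \<nu>"
      using limit[OF q \<kappa>] \<nu>_props by (intro laplace_transform_unique \<kappa> \<nu>) auto
    with \<kappa> show "weak_conv_m (\<mu> \<circ> q) \<nu>" by simp
  qed
  with \<nu>_props \<nu>(1) show ?thesis by (intro that) auto
qed

text \<open>Both sides of the stability equation have the same Laplace transform, with shift \<open>d = 0\<close>. The law
  is not degenerate, as a constant would give an exponent linear in \<open>s\<close>.\<close>

lemma stable_rv_of_laplace_transform:
  fixes \<nu> :: "real measure"
  assumes \<nu>: "real_distribution \<nu>" "AE x in \<nu>. 0 \<le> x"
    and lap: "\<And>s. s > 0 \<Longrightarrow> (LINT x|\<nu>. exp (- (s * x))) = exp (- (K * s powr \<alpha>))"
    and K: "K > 0" and \<alpha>: "0 < \<alpha>" "\<alpha> < 1"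
  shows "stable_rv \<nu> \<alpha> (\<lambda>x. x)"
proof -
  interpret real_distribution \<nu> by fact
  have id: "distr \<nu> borel (\<lambda>x. x) = \<nu>"
    by (rule distr_id2) simp
  have nonconst: "\<not> (AE x in \<nu>. x = c)" for c
  proof
    assume c: "AE x in \<nu>. x = c"
    have *: "s * c = K * s powr \<alpha>" if "s > 0" for s
    proof -
      have "(LINT x|\<nu>. exp (- (s * x))) = (LINT x|\<nu>. exp (- (s * c)))"
      proof (rule integral_cong_AE)
        show "AE x in \<nu>. exp (- (s * x)) = exp (- (s * c))"
          using c by eventually_elim simp
      qed auto
      then show ?thesis using lap[OF that] prob_space by simp
    qed
    have "2 powr \<alpha> = (2 :: real)"
      using *[of 1] *[of 2] K by simp
    moreover have "2 powr \<alpha> < 2 powr (1 :: real)"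
      using \<alpha> by (intro powr_less_mono) auto
    ultimately show False by simp
  qed
  have stab: "distr (\<nu> \<Otimes>\<^sub>M \<nu>) borel (\<lambda>(z\<^sub>1, z\<^sub>2). a * z\<^sub>1 + b * z\<^sub>2) =
      distr \<nu> borel (\<lambda>x. (a powr \<alpha> + b powr \<alpha>) powr (1 / \<alpha>) * x + 0)"
    if ab: "a > 0" "b > 0" for a b
  proof -
    define c where "c = (a powr \<alpha> + b powr \<alpha>) powr (1 / \<alpha>)"
    have c: "c > 0" "c powr \<alpha> = a powr \<alpha> + b powr \<alpha>"
      using ab \<alpha> add_pos_pos[of "a powr \<alpha>" "b powr \<alpha>"] by (auto simp: c_def powr_powr)
    interpret P: pair_prob_space \<nu> \<nu> ..
    have pos2: "AE z in \<nu> \<Otimes>\<^sub>M \<nu>. 0 \<le> fst z \<and> 0 \<le> snd z"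
    proof (rule P.AE_pair_measure)
      show "AE x in \<nu>. AE y in \<nu>. 0 \<le> fst (x, y) \<and> 0 \<le> snd (x, y)"
        using \<nu>(2)
      proof eventually_elim
        case (elim x)
        show ?case using \<nu>(2) by eventually_elim (use elim in simp)
      qed
    qed measurable
    have pos_sum: "AE z in \<nu> \<Otimes>\<^sub>M \<nu>. 0 \<le> a * fst z + b * snd z"
      using pos2 by eventually_elim (use ab in simp)
    have "distr (\<nu> \<Otimes>\<^sub>M \<nu>) borel (\<lambda>z. a * fst z + b * snd z) = distr \<nu> borel (\<lambda>x. c * x)"
    proof (rule laplace_transform_unique)
      show "real_distribution (distr (\<nu> \<Otimes>\<^sub>M \<nu>) borel (\<lambda>z. a * fst z + b * snd z))"
        by (intro P.real_distribution_distr) measurable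
      show "real_distribution (distr \<nu> borel (\<lambda>x. c * x))"
        by (intro real_distribution_distr) measurable
      show "AE x in distr (\<nu> \<Otimes>\<^sub>M \<nu>) borel (\<lambda>z. a * fst z + b * snd z). 0 \<le> x"
        using pos_sum by (subst AE_distr_iff) auto
      show "AE x in distr \<nu> borel (\<lambda>x. c * x). 0 \<le> x"
        using \<nu>(2) c by (subst AE_distr_iff) (auto elim!: eventually_mono)
      fix s :: real assume s: "s > 0"
      have "(LINT z|(\<nu> \<Otimes>\<^sub>M \<nu>). exp (- (s * (a * fst z + b * snd z))))
          = (LINT x|\<nu>. (LINT y|\<nu>. exp (- (s * (a * fst (x, y) + b * snd (x, y))))))"
      proof (rule P.integral_fst'[symmetric])
        show "integrable (\<nu> \<Otimes>\<^sub>M \<nu>) (\<lambda>z. exp (- (s * (a * fst z + b * snd z))))"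
          using pos_sum s by (intro P.integrable_const_bound[where B=1]) (auto elim!: eventually_mono)
      qed
      also have "\<dots> = (LINT x|\<nu>. exp (- (s * a * x)) * (LINT y|\<nu>. exp (- (s * b * y))))"
        by (subst integral_mult_right_zero[symmetric]) (simp add: algebra_simps flip: exp_add)
      also have "\<dots> = exp (- (K * (s * a) powr \<alpha>)) * exp (- (K * (s * b) powr \<alpha>))"
        using lap[of "s * a"] lap[of "s * b"] s ab by simp
      also have "\<dots> = exp (- (K * (s * c) powr \<alpha>))"
        using s ab c by (simp add: powr_mult algebra_simps flip: exp_add)
      also have "\<dots> = (LINT x|\<nu>. exp (- (s * (c * x))))"
        using lap[of "s * c"] s c by (simp add: mult.assoc)
      finally show "(LINT x|(distr (\<nu> \<Otimes>\<^sub>M \<nu>) borel (\<lambda>z. a * fst z + b * snd z)). exp (- (s * x)))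
          = (LINT x|(distr \<nu> borel (\<lambda>x. c * x)). exp (- (s * x)))"
        by (subst (1 2) integral_distr) auto
    qed
    then show ?thesis by (simp add: c_def case_prod_beta')
  qed
  show ?thesis
    unfolding stable_rv_def id
    using nonconst \<alpha> by (auto simp: prob_space_axioms stab intro!: exI[of _ 0])
qed

section \<open>Asymptotics of the partial sums\<close>

text \<open>The counterpart of \<open>p \<le> exp (- (1 - p))\<close> from below: between them they turn products of factors
  near \<open>1\<close> into exponentials of sums without logarithms.\<close>

lemma exp_le_of_pos:
  fixes p :: real
  assumes "p > 0"
  shows "exp (- ((1 - p) / p)) \<le> p"
proof -
  have "1 / p \<le> exp ((1 - p) / p)"
    using exp_ge_add_one_self[of "(1 - p) / p"] assms by (simp add: diff_divide_distrib)
  then show ?thesis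
    using assms by (simp add: exp_minus field_simps)
qed

context stationary_branching_immigration
begin

context
  fixes a :: "nat \<Rightarrow> real" and \<alpha> \<mu> :: real
  assumes int_A: "integrable M (\<lambda>\<omega>. real (A \<omega>))" and mean_A: "expectation (\<lambda>\<omega>. real (A \<omega>)) = \<mu>"
    and \<mu>: "0 < \<mu>" "\<mu> < 1" and \<alpha>: "0 < \<alpha>" "\<alpha> < 1"
    and a_top: "filterlim a at_top sequentially"
    and tail_pos: "\<And>x. 0 < prob {\<omega> \<in> space M. real (X 0 \<omega>) > x}"
    and tail_lim: "\<And>u. u > 0 \<Longrightarrow>
      (\<lambda>n. real n * prob {\<omega> \<in> space M. real (X 0 \<omega>) > a n * u}) \<longlonglongrightarrow> u powr (-\<alpha>)"
begin

lemma pgf_marginal_limit: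
  assumes "(\<lambda>n. a n * (1 - x n)) \<longlonglongrightarrow> s" "s > 0"
  shows "(\<lambda>n. real n * (1 - pgf M (X 0) (x n))) \<longlonglongrightarrow> s powr \<alpha> * Gamma (1 - \<alpha>)"
  by (rule pgf_limit[OF X_rv \<alpha> tail_pos tail_lim a_top assms])

lemma pgf_marginal_tendsto_1:
  assumes "(\<lambda>n. a n * (1 - x n)) \<longlonglongrightarrow> s" "s > 0"
  shows "(\<lambda>n. pgf M (X 0) (x n)) \<longlonglongrightarrow> 1"
proof -
  have "(\<lambda>n. 1 - real n * (1 - pgf M (X 0) (x n)) * inverse (real n)) \<longlonglongrightarrow> 1 - s powr \<alpha> * Gamma (1 - \<alpha>) * 0"
    by (intro tendsto_intros pgf_marginal_limit assms lim_inverse_n)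
  moreover have "\<forall>\<^sub>F n in sequentially. 1 - real n * (1 - pgf M (X 0) (x n)) * inverse (real n) = pgf M (X 0) (x n)"
    using eventually_gt_at_top[of 0] by eventually_elim (simp add: field_simps)
  ultimately show ?thesis
    using Lim_transform_eventually by fastforce
qed

text \<open>From \<open>G x = g x * G (f x)\<close> one gets \<open>1 - g x = ((1 - G x) - (1 - G (f x))) / G (f x)\<close>, and the
  limits of both terms of the numerator are known.\<close>

lemma pgf_immigration_limit:
  assumes x: "\<And>n. 0 \<le> x n" "\<And>n. x n \<le> 1" and lim: "(\<lambda>n. a n * (1 - x n)) \<longlonglongrightarrow> s" and s: "s > 0"
  shows "(\<lambda>n. real n * (1 - pgf M B (x n))) \<longlonglongrightarrow> (1 - \<mu> powr \<alpha>) * Gamma (1 - \<alpha>) * s powr \<alpha>"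
proof -
  let ?f = "pgf M A" and ?g = "pgf M B" and ?G = "pgf M (X 0)"
  have "(\<lambda>n. a n * (1 - ?f (x n))) \<longlonglongrightarrow> s * \<mu>"
    using one_minus_pgf_limit[OF A_rv int_A x tendsto_1_of_scaled[OF a_top lim] lim] by (simp add: mean_A)
  then have Gf: "(\<lambda>n. real n * (1 - ?G (?f (x n)))) \<longlonglongrightarrow> (s * \<mu>) powr \<alpha> * Gamma (1 - \<alpha>)"
    and Gf1: "(\<lambda>n. ?G (?f (x n))) \<longlonglongrightarrow> 1"
    using s \<mu> by (auto intro: pgf_marginal_limit pgf_marginal_tendsto_1)
  have "(\<lambda>n. (real n * (1 - ?G (x n)) - real n * (1 - ?G (?f (x n)))) / ?G (?f (x n)))
      \<longlonglongrightarrow> (s powr \<alpha> * Gamma (1 - \<alpha>) - (s * \<mu>) powr \<alpha> * Gamma (1 - \<alpha>)) / 1"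
    by (intro tendsto_divide tendsto_diff pgf_marginal_limit lim s Gf Gf1) simp
  moreover have "\<forall>\<^sub>F n in sequentially. 0 < ?G (?f (x n))"
    using Gf1 by (rule order_tendstoD) simp
  then have "\<forall>\<^sub>F n in sequentially.
      (real n * (1 - ?G (x n)) - real n * (1 - ?G (?f (x n)))) / ?G (?f (x n)) = real n * (1 - ?g (x n))"
  proof eventually_elim
    case (elim n)
    have "?G (x n) = ?g (x n) * ?G (?f (x n))"
      by (rule pgf_fixed_point) (fact x)+
    then show ?case using elim by (simp add: field_simps)
  qed
  ultimately have "(\<lambda>n. real n * (1 - ?g (x n)))
      \<longlonglongrightarrow> (s powr \<alpha> * Gamma (1 - \<alpha>) - (s * \<mu>) powr \<alpha> * Gamma (1 - \<alpha>)) / 1"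
    by (rule Lim_transform_eventually)
  then show ?thesis
    using s \<mu> by (simp add: powr_mult algebra_simps)
qed

text \<open>The bound on \<open>1 - v j\<close> is uniform in \<open>j\<close>: one step maps it to at most
  \<open>(1 - z) + \<mu> * (1 - v j)\<close>, whose fixed point is \<open>(1 - z) / (1 - \<mu>)\<close>.\<close>

lemma progeny_pgf_bounds:
  fixes z :: real
  assumes z: "0 \<le> z" "z \<le> 1"
  defines "v \<equiv> \<lambda>j. ((\<lambda>x. z * pgf M A x) ^^ j) 1"
  shows "0 \<le> v j" "v j \<le> 1" "1 - v j \<le> (1 - z) / (1 - \<mu>)" "i \<le> j \<Longrightarrow> v j \<le> v i"
proof -
  have v0: "v 0 = 1" and v_Suc: "v (Suc j) = z * pgf M A (v j)" for j
    by (simp_all add: v_def)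
  have v: "0 \<le> v j \<and> v j \<le> 1" for j
    by (induction j) (auto simp: v_Suc v0 z intro!: mult_le_one mult_nonneg_nonneg pgf_le_one pgf_nonneg)
  then show "0 \<le> v j" "v j \<le> 1" by auto
  show "1 - v j \<le> (1 - z) / (1 - \<mu>)"
  proof (induction j)
    case (Suc j)
    have "1 - v (Suc j) = (1 - z) + z * (1 - pgf M A (v j))"
      by (simp add: v_Suc algebra_simps)
    also have "\<dots> \<le> (1 - z) + 1 * (\<mu> * (1 - v j))"
      using one_minus_pgf_le[OF A_rv int_A, of "v j"] v[of j] z pgf_le_one[of "v j" A]
      by (intro add_left_mono mult_mono) (auto simp: mean_A)
    also have "\<dots> \<le> (1 - z) + 1 * (\<mu> * ((1 - z) / (1 - \<mu>)))"
      using Suc.IH \<mu> by (intro add_left_mono mult_left_mono) auto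
    also have "\<dots> = (1 - z) / (1 - \<mu>)"
      using \<mu> by (simp add: field_simps)
    finally show ?case .
  qed (use z \<mu> in \<open>simp add: v0\<close>)
  have "v (Suc j) \<le> v j" for j
  proof (induction j)
    case 0
    then show ?case using v[of "Suc 0"] by (simp add: v0)
  next
    case (Suc j)
    then have "pgf M A (v (Suc j)) \<le> pgf M A (v j)"
      using v by (intro pgf_mono) auto
    then show ?case
      using z unfolding v_Suc by (intro mult_left_mono)
  qed
  then show "i \<le> j \<Longrightarrow> v j \<le> v i"
    by (rule lift_Suc_antimono_le)
qed

lemma progeny_pgf_limit:
  fixes z :: "nat \<Rightarrow> real"
  assumes z: "\<And>n. 0 \<le> z n" "\<And>n. z n \<le> 1" and lim: "(\<lambda>n. a n * (1 - z n)) \<longlonglongrightarrow> s"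
  shows "(\<lambda>n. a n * (1 - ((\<lambda>x. z n * pgf M A x) ^^ j) 1)) \<longlonglongrightarrow> s * (1 - \<mu> ^ j) / (1 - \<mu>)"
proof (induction j)
  case (Suc j)
  define v where "v n = ((\<lambda>x. z n * pgf M A x) ^^ j) 1" for n
  have v: "0 \<le> v n" "v n \<le> 1" for n
    unfolding v_def by (rule progeny_pgf_bounds z)+
  have IH: "(\<lambda>n. a n * (1 - v n)) \<longlonglongrightarrow> s * (1 - \<mu> ^ j) / (1 - \<mu>)"
    using Suc.IH by (simp add: v_def)
  have "(\<lambda>n. a n * (1 - z n) + z n * (a n * (1 - pgf M A (v n))))
      \<longlonglongrightarrow> s + 1 * (s * (1 - \<mu> ^ j) / (1 - \<mu>) * \<mu>)"
    using one_minus_pgf_limit[OF A_rv int_A v tendsto_1_of_scaled[OF a_top IH] IH] unfolding mean_A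
    by (rule tendsto_add[OF lim tendsto_mult[OF tendsto_1_of_scaled[OF a_top lim]]])
  also have "s + 1 * (s * (1 - \<mu> ^ j) / (1 - \<mu>) * \<mu>) = s * (1 - \<mu> ^ Suc j) / (1 - \<mu>)"
    using \<mu> by (simp add: field_simps)
  also have "(\<lambda>n. a n * (1 - z n) + z n * (a n * (1 - pgf M A (v n))))
      = (\<lambda>n. a n * (1 - ((\<lambda>x. z n * pgf M A x) ^^ Suc j) 1))"
    by (simp add: v_def algebra_simps)
  finally show ?case .
qed simp

text \<open>Lower bound: every factor is at least its value at \<open>1 - (1 - z) / (1 - \<mu>)\<close>. Upper bound: for
  fixed \<open>J\<close>, all factors but the first \<open>J\<close> are at most \<open>g (v J)\<close>. The two bounds meet as \<open>J\<close> tends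
  to infinity after \<open>n\<close>.\<close>

lemma laplace_partial_sums_limit:
  assumes s: "s > 0"
  shows "(\<lambda>n. expectation (\<lambda>\<omega>. exp (- (s * ((\<Sum>t = 1..int n. real (X t \<omega>)) / a n)))))
    \<longlonglongrightarrow> exp (- ((1 - \<mu> powr \<alpha>) * Gamma (1 - \<alpha>) / (1 - \<mu>) powr \<alpha> * s powr \<alpha>))"
proof -
  let ?f = "pgf M A" and ?g = "pgf M B" and ?G = "pgf M (X 0)"
  define K where "K = (1 - \<mu> powr \<alpha>) * Gamma (1 - \<alpha>)"
  \<comment> \<open>The scaling \<open>a n\<close> may be nonpositive for small \<open>n\<close>; the value \<open>1\<close> keeps \<open>z n\<close> in \<open>[0, 1]\<close>.\<close>
  define z where "z n = (if 0 < a n then exp (- (s / a n)) else 1)" for n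
  define v where "v n j = ((\<lambda>x. z n * ?f x) ^^ j) 1" for n j
  define P where "P n = (\<Prod>j<n. ?g (v n j)) * ?G (v n n)" for n
  have z: "0 \<le> z n" "z n \<le> 1" for n
    using s by (auto simp: z_def)
  have v: "0 \<le> v n j" "v n j \<le> 1" for n j
    unfolding v_def by (rule progeny_pgf_bounds z)+
  have ev_a: "\<forall>\<^sub>F n in sequentially. 0 < a n"
    using a_top by (simp add: filterlim_at_top_dense)
  have g: "0 \<le> ?g x" "?g x \<le> 1" and G: "0 \<le> ?G x" "?G x \<le> 1" if "0 \<le> x" "x \<le> 1" for x
    using that by (auto intro: pgf_nonneg pgf_le_one)

  have P_eq: "\<forall>\<^sub>F n in sequentially. P n = expectation (\<lambda>\<omega>. exp (- (s * ((\<Sum>t = 1..int n. real (X t \<omega>)) / a n))))"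
    using ev_a
  proof eventually_elim
    case (elim n)
    have "exp (- (s * ((\<Sum>t = 1..int n. real (X t \<omega>)) / a n))) = z n ^ (\<Sum>t = 1..int n. X t \<omega>)" for \<omega>
      using elim by (simp add: z_def flip: exp_of_nat_mult)
    then show ?case
      using pgf_sum[OF z, of n n] by (simp add: P_def v_def)
  qed

  have z_lim: "(\<lambda>n. a n * (1 - z n)) \<longlonglongrightarrow> s"
  proof -
    have "((\<lambda>h. (exp (- (s * (0 + h))) - exp (- (s * 0))) / h) \<longlongrightarrow> - s) (at 0)"
      by (rule DERIV_D) (auto intro!: derivative_eq_intros)
    then have "((\<lambda>h. - ((exp (- (s * (0 + h))) - exp (- (s * 0))) / h)) \<longlongrightarrow> - (- s)) (at_right 0)"
      by (rule tendsto_minus[OF filterlim_mono]) (simp_all add: at_le)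
    moreover have "filterlim (\<lambda>n. inverse (a n)) (at_right 0) sequentially"
      by (rule filterlim_compose[OF filterlim_inverse_at_right_top a_top])
    ultimately have "(\<lambda>n. - ((exp (- (s * (0 + inverse (a n)))) - exp (- (s * 0))) / inverse (a n))) \<longlonglongrightarrow> - (- s)"
      by (rule filterlim_compose)
    then have "(\<lambda>n. a n * (1 - exp (- (s / a n)))) \<longlonglongrightarrow> s"
      by (simp add: field_simps)
    moreover have "\<forall>\<^sub>F n in sequentially. a n * (1 - exp (- (s / a n))) = a n * (1 - z n)"
      using ev_a by eventually_elim (simp add: z_def)
    ultimately show ?thesis by (rule Lim_transform_eventually)
  qed

  have lower: "\<forall>\<^sub>F n in sequentially. b < P n" if b: "b < exp (- (K * (s / (1 - \<mu>)) powr \<alpha>))" for b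
  proof -
    \<comment> \<open>The truncation at \<open>0\<close> keeps \<open>y n\<close> in \<open>[0, 1]\<close> and is inactive for large \<open>n\<close>.\<close>
    define y where "y n = max 0 (1 - (1 - z n) / (1 - \<mu>))" for n
    have y: "0 \<le> y n" "y n \<le> 1" "y n \<le> v n j" for n j
      using progeny_pgf_bounds(3)[OF z(1)[of n] z(2)[of n], of j] v[of n j] z[of n] \<mu> by (auto simp: y_def v_def)
    have "(\<lambda>n. 1 - (1 - z n) / (1 - \<mu>)) \<longlonglongrightarrow> 1 - (1 - 1) / (1 - \<mu>)"
      using \<mu> by (intro tendsto_intros tendsto_1_of_scaled[OF a_top z_lim]) auto
    then have "\<forall>\<^sub>F n in sequentially. 0 < 1 - (1 - z n) / (1 - \<mu>)"
      by (rule order_tendstoD) simp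
    then have "\<forall>\<^sub>F n in sequentially. a n * (1 - z n) / (1 - \<mu>) = a n * (1 - y n)"
      by eventually_elim (simp add: y_def)
    moreover have "(\<lambda>n. a n * (1 - z n) / (1 - \<mu>)) \<longlonglongrightarrow> s / (1 - \<mu>)"
      using \<mu> by (intro tendsto_intros z_lim) auto
    ultimately have y_lim: "(\<lambda>n. a n * (1 - y n)) \<longlonglongrightarrow> s / (1 - \<mu>)"
      by (rule Lim_transform_eventually[rotated])
    have s': "s / (1 - \<mu>) > 0" using s \<mu> by simp
    have gy: "(\<lambda>n. real n * (1 - ?g (y n))) \<longlonglongrightarrow> K * (s / (1 - \<mu>)) powr \<alpha>"
      unfolding K_def by (rule pgf_immigration_limit[OF y(1,2) y_lim s'])
    have "(\<lambda>n. 1 - real n * (1 - ?g (y n)) * inverse (real n)) \<longlonglongrightarrow> 1 - K * (s / (1 - \<mu>)) powr \<alpha> * 0"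
      by (intro tendsto_intros gy lim_inverse_n)
    moreover have "\<forall>\<^sub>F n in sequentially. 1 - real n * (1 - ?g (y n)) * inverse (real n) = ?g (y n)"
      using eventually_gt_at_top[of 0] by eventually_elim (simp add: field_simps)
    ultimately have gy1: "(\<lambda>n. ?g (y n)) \<longlonglongrightarrow> 1"
      using Lim_transform_eventually by fastforce
    have "(\<lambda>n. exp (- (real n * (1 - ?g (y n)) / ?g (y n))) * ?G (y n))
        \<longlonglongrightarrow> exp (- (K * (s / (1 - \<mu>)) powr \<alpha> / 1)) * 1"
      by (intro tendsto_intros gy gy1 pgf_marginal_tendsto_1[OF y_lim s']) simp
    then have "\<forall>\<^sub>F n in sequentially. b < exp (- (real n * (1 - ?g (y n)) / ?g (y n))) * ?G (y n)"
      using b by (intro order_tendstoD(1)) auto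
    moreover have "\<forall>\<^sub>F n in sequentially. 0 < ?g (y n)"
      using gy1 by (rule order_tendstoD) simp
    ultimately show ?thesis
    proof eventually_elim
      case (elim n)
      have "exp (- (real n * (1 - ?g (y n)) / ?g (y n))) = exp (- ((1 - ?g (y n)) / ?g (y n))) ^ n"
        by (simp flip: exp_of_nat_mult)
      also have "\<dots> \<le> ?g (y n) ^ n"
        using elim by (intro power_mono exp_le_of_pos) auto
      also have "\<dots> = (\<Prod>j<n. ?g (y n))" by simp
      also have "\<dots> \<le> (\<Prod>j<n. ?g (v n j))"
        using y v g by (intro prod_mono conjI pgf_mono B_rv) auto
      finally have "exp (- (real n * (1 - ?g (y n)) / ?g (y n))) * ?G (y n) \<le> P n"
        unfolding P_def using y v g G by (intro mult_mono pgf_mono X_rv prod_nonneg) auto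
      with elim show ?case by linarith
    qed
  qed

  have upper: "\<forall>\<^sub>F n in sequentially. P n < b" if b: "exp (- (K * (s / (1 - \<mu>)) powr \<alpha>)) < b" for b
  proof -
    define \<sigma> where "\<sigma> J = s * (1 - \<mu> ^ J) / (1 - \<mu>)" for J
    have "(\<lambda>J. \<sigma> J) \<longlonglongrightarrow> s * (1 - 0) / (1 - \<mu>)"
      unfolding \<sigma>_def using \<mu> by (intro tendsto_intros LIMSEQ_realpow_zero) auto
    then have "(\<lambda>J. exp (- (K * \<sigma> J powr \<alpha>))) \<longlonglongrightarrow> exp (- (K * (s / (1 - \<mu>)) powr \<alpha>))"
      using s \<mu> by (intro tendsto_intros) auto
    then have "\<forall>\<^sub>F J in sequentially. exp (- (K * \<sigma> J powr \<alpha>)) < b"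
      using b by (rule order_tendstoD)
    then have "\<forall>\<^sub>F J in sequentially. exp (- (K * \<sigma> J powr \<alpha>)) < b \<and> 0 < J"
      using eventually_gt_at_top[of 0] by eventually_elim simp
    then obtain J where J: "exp (- (K * \<sigma> J powr \<alpha>)) < b" "0 < J"
      using eventually_happens trivial_limit_sequentially by blast
    have "\<mu> ^ J < 1" using \<mu> J(2) by (simp add: power_less_one_iff)
    then have \<sigma>J: "\<sigma> J > 0" using s \<mu> by (simp add: \<sigma>_def)
    have v_lim: "(\<lambda>n. a n * (1 - v n J)) \<longlonglongrightarrow> \<sigma> J"
      unfolding v_def \<sigma>_def by (rule progeny_pgf_limit[OF z z_lim])
    have gv: "(\<lambda>n. real n * (1 - ?g (v n J))) \<longlonglongrightarrow> K * \<sigma> J powr \<alpha>"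
      unfolding K_def by (rule pgf_immigration_limit[OF v v_lim \<sigma>J])
    have "(\<lambda>n. real n * (1 - ?g (v n J)) - real J * (real n * (1 - ?g (v n J)) * inverse (real n)))
        \<longlonglongrightarrow> K * \<sigma> J powr \<alpha> - real J * (K * \<sigma> J powr \<alpha> * 0)"
      by (intro tendsto_intros gv lim_inverse_n)
    then have "(\<lambda>n. exp (- (real n * (1 - ?g (v n J)) - real J * (real n * (1 - ?g (v n J)) * inverse (real n)))))
        \<longlonglongrightarrow> exp (- (K * \<sigma> J powr \<alpha>))"
      by (intro tendsto_intros) simp
    then have "\<forall>\<^sub>F n in sequentially.
        exp (- (real n * (1 - ?g (v n J)) - real J * (real n * (1 - ?g (v n J)) * inverse (real n)))) < b"
      using J(1) by (rule order_tendstoD)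
    then show ?thesis
      using eventually_gt_at_top[of J]
    proof eventually_elim
      case (elim n)
      have "P n \<le> (\<Prod>j<n. ?g (v n j)) * 1"
        unfolding P_def using v g G by (intro mult_left_mono prod_nonneg) auto
      also have "\<dots> \<le> (\<Prod>j<n. exp (- (if j < J then 0 else 1 - ?g (v n J))))"
      proof (simp only: mult_1_right, intro prod_mono conjI)
        fix j assume "j \<in> {..<n}"
        show "0 \<le> ?g (v n j)" using g v by simp
        show "?g (v n j) \<le> exp (- (if j < J then 0 else 1 - ?g (v n J)))"
        proof (cases "j < J")
          case True
          then show ?thesis using g v by simp
        next
          case False
          then have "v n j \<le> v n J"
            unfolding v_def by (intro progeny_pgf_bounds z) simp
          then have "?g (v n j) \<le> ?g (v n J)"
            using v by (intro pgf_mono B_rv) auto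
          also have "\<dots> \<le> exp (- (1 - ?g (v n J)))"
            using exp_ge_add_one_self[of "- (1 - ?g (v n J))"] by simp
          finally show ?thesis using False by simp
        qed
      qed
      also have "\<dots> = exp (- (\<Sum>j<n. if j < J then 0 else 1 - ?g (v n J)))"
        by (simp add: exp_sum sum_negf[symmetric] del: sum.If_cases)
      also have "(\<Sum>j<n. if j < J then 0 else 1 - ?g (v n J)) = (\<Sum>j\<in>{J..<n}. 1 - ?g (v n J))"
        by (rule sum.mono_neutral_cong_right) auto
      also have "\<dots> = real n * (1 - ?g (v n J)) - real J * (real n * (1 - ?g (v n J)) * inverse (real n))"
        using elim by (simp add: of_nat_diff algebra_simps)
      finally show ?case using elim by linarith
    qed
  qed

  have "P \<longlonglongrightarrow> exp (- (K * (s / (1 - \<mu>)) powr \<alpha>))"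
    by (rule order_tendstoI) (fact lower upper)+
  then have "(\<lambda>n. expectation (\<lambda>\<omega>. exp (- (s * ((\<Sum>t = 1..int n. real (X t \<omega>)) / a n)))))
    \<longlonglongrightarrow> exp (- (K * (s / (1 - \<mu>)) powr \<alpha>))"
    using P_eq by (rule Lim_transform_eventually)
  then show ?thesis
    using s \<mu> by (simp add: K_def powr_divide)
qed

end
end

theorem mainTheorem4:
  fixes M :: "'a measure"
    and A B :: "'a \<Rightarrow> nat"
    and \<xi> :: "int \<Rightarrow> nat \<Rightarrow> 'a \<Rightarrow> nat"
    and \<eta> :: "int \<Rightarrow> 'a \<Rightarrow> nat"
    and X :: "int \<Rightarrow> 'a \<Rightarrow> nat"
    and L :: "real \<Rightarrow> real"
    and a :: "nat \<Rightarrow> real"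
    and \<alpha> \<mu> :: real
  assumes process: "stationary_branching_immigration M A B \<xi> \<eta> X"
    and mean_A: "integrable M (\<lambda>\<omega>. real (A \<omega>))" "(LINT \<omega>|M. real (A \<omega>)) = \<mu>"
    and subcritical: "0 < \<mu>" "\<mu> < 1"
    and index: "0 < \<alpha>" "\<alpha> < 1"
    and L: "slowly_varying L"
    and tail_B: "\<And>x. x > 0 \<Longrightarrow>
      measure M {\<omega> \<in> space M. real (B \<omega>) > x} = x powr (-\<alpha>) * L x"
    and normalization: "\<And>u. u > 0 \<Longrightarrow>
      (\<lambda>n. real n * measure M {\<omega> \<in> space M. real (X 0 \<omega>) > a n * u}) \<longlonglongrightarrow> u powr (-\<alpha>)"
  shows "\<exists>(N :: real measure) (Z :: real \<Rightarrow> real).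
    stable_rv N \<alpha> Z \<and>
    weak_conv_m (\<lambda>n. distr M borel (\<lambda>\<omega>. (\<Sum>t = 1..int n. real (X t \<omega>)) / a n))
      (distr N borel Z)"
proof -
  interpret stationary_branching_immigration M A B \<xi> \<eta> X by (rule process)
  define F where "F x = prob {\<omega> \<in> space M. real (X 0 \<omega>) > x}" for x
  have anti: "antimono F"
    unfolding F_def by (intro antimonoI finite_measure_mono) auto
  have pos: "0 < F x" for x
  proof -
    obtain x\<^sub>0 where x\<^sub>0: "\<And>x. x \<ge> x\<^sub>0 \<Longrightarrow> L x > 0"
      using L by (auto simp: slowly_varying_def)
    \<comment> \<open>\<open>X 0\<close> has unbounded support because it is stochastically larger than the immigration.\<close>
    define y where "y = max x (max 1 x\<^sub>0)"
    have "0 < y powr (-\<alpha>) * L y"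
      using x\<^sub>0[of y] by (intro mult_pos_pos) (auto simp: y_def)
    also have "\<dots> = prob {\<omega> \<in> space M. real (B \<omega>) > y}"
      by (rule tail_B[symmetric]) (simp add: y_def)
    also have "\<dots> \<le> F y"
      unfolding F_def by (rule tail_immigration_le)
    also have "\<dots> \<le> F x"
      by (rule antimonoD[OF anti]) (simp add: y_def)
    finally show ?thesis .
  qed
  have a_top: "filterlim a at_top sequentially"
    by (rule filterlim_scaling_at_top[OF anti pos, of a \<alpha>]) (simp add: F_def normalization)
  define K where "K = (1 - \<mu> powr \<alpha>) * Gamma (1 - \<alpha>) / (1 - \<mu>) powr \<alpha>"
  have "\<mu> powr \<alpha> < 1"
    using powr_less_mono2[of \<alpha> \<mu> 1] subcritical index by simp
  then have K: "K > 0"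
    using subcritical index by (simp add: K_def Gamma_real_pos)
  define S where "S n \<omega> = (\<Sum>t = 1..int n. real (X t \<omega>)) / a n" for n \<omega>
  have S_rv [measurable]: "S n \<in> borel_measurable M" for n
    unfolding S_def by measurable
  have ev_a: "\<forall>\<^sub>F n in sequentially. 0 < a n"
    using a_top by (simp add: filterlim_at_top_dense)
  obtain \<nu> where \<nu>: "real_distribution \<nu>" "AE x in \<nu>. 0 \<le> x"
    "\<And>s. s > 0 \<Longrightarrow> (LINT x|\<nu>. exp (- (s * x))) = exp (- (K * s powr \<alpha>))"
    "weak_conv_m (\<lambda>n. distr M borel (S n)) \<nu>"
  proof (rule laplace_continuity)
    show "real_distribution (distr M borel (S n))" for n
      by (rule real_distribution_distr) measurable
    show "\<forall>\<^sub>F n in sequentially. AE x in distr M borel (S n). 0 \<le> x"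
      using ev_a
    proof eventually_elim
      case (elim n)
      then show ?case
        by (subst AE_distr_iff) (auto simp: S_def sum_nonneg)
    qed
    show "(\<lambda>n. LINT x|(distr M borel (S n)). exp (- (s * x))) \<longlonglongrightarrow> exp (- (K * s powr \<alpha>))" if "s > 0" for s
    proof -
      have "(LINT x|(distr M borel (S n)). exp (- (s * x))) = expectation (\<lambda>\<omega>. exp (- (s * S n \<omega>)))" for n
        by (subst integral_distr) auto
      then show ?thesis
        unfolding K_def S_def
        using laplace_partial_sums_limit[OF mean_A subcritical index a_top pos[unfolded F_def] normalization that]
        by simp
    qed
    have "((\<lambda>s. exp (- (K * s powr \<alpha>))) \<longlongrightarrow> exp (- (K * 0))) (at_right 0)"
      using index by (intro tendsto_intros tendsto_zero_powrI tendsto_ident_at tendsto_const)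
        (auto simp: eventually_at_right_field intro: exI[of _ 1])
    then show "((\<lambda>s. exp (- (K * s powr \<alpha>))) \<longlongrightarrow> 1) (at_right 0)" by simp
  qed (rule that)
  have "stable_rv \<nu> \<alpha> (\<lambda>x. x)"
    by (rule stable_rv_of_laplace_transform[OF \<nu>(1,2,3) K index])
  moreover have "distr \<nu> borel (\<lambda>x. x) = \<nu>"
    using \<nu>(1) by (intro distr_id2) (simp add: real_distribution.events_eq_borel)
  ultimately show ?thesis
    using \<nu>(4) unfolding S_def by (intro exI[of _ \<nu>] exI[of _ "\<lambda>x. x"]) simp
qed

end
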